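(* Consider the ongoing market with warehouses described in the context, where the demand functions satisfy fixed spending, WGS and elasticity $E\ge1$ (as defined in the context). Assume that at all times, for all $i$: $|\tilde w_i-w_i|\le\frac13w_i$ and $x_i\le d\,\tilde w_i$, where $d\ge2$. Assume $1<\alpha_2<2$, $\frac{\alpha_2}{2}+\alpha_1\max\{\frac32,d-1\}\le1$, $\lambda E<1$, $\lambda\alpha_1+\frac43\lambda\big(1+\frac{2Ed}{1-\lambda E}+\frac12\alpha_2\big)\le1$, $4\kappa(1+\alpha_2)\le\lambda\alpha_1\le\frac12$, and $\frac{\kappa(\alpha_2-1)}2\le1$. Then for all $t\ge0$, \[ \phi(t+1)\le\Big(1-\frac{\kappa(\alpha_2-1)}{4}\Big)\phi(t). \] Moreover, if $\phi(s)\ge2(1+2\alpha_2)\sum_i|\tilde w_i(s)-w_i|\,p_i(s)$ for all $s\in[t,t+1]$, then $\phi(t+1)\le\big(1-\frac{\lambda\alpha_1}{8(1+\alpha_2)}\big)\phi(t)$.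
   Context: Market: $n$ goods with daily supply rates $w_i>0$, demand functions $x_i:(0,\infty)^n\to(0,\infty)$ (instantaneous daily rates) satisfying (fixed spending) $\sum_ip_ix_i(p)=M$ for all $p$ (constant $M>0$); (WGS) for $j\ne i$, $x_j(p)$ is non-decreasing in $p_i$; (elasticity $E$) $x_i$ differentiable in $p_i$ with $\frac{x_i}{p_i}\le-\frac{\partial x_i}{\partial p_i}\le E\frac{x_i}{p_i}$. Dynamics: continuous time $t\ge0$ (unit one day); $p(t)$ piecewise constant, right-continuous, finitely many changes in bounded intervals; $x_i(t)=x_i(p(t))$. Each good has a warehouse with stock $s_i(t)$, $\frac{ds_i}{dt}=w_i-x_i(t)$, target stock $s_i^*$, and parameter $\kappa>0$; the target demand is $\tilde w_i(t)=w_i+\kappa(s_i(t)-s_i^* )$. Each price changes only at its own update times; $0$ is an update time for all goods and consecutive update times of a good are at most $1$ apart. $\tau_i(t)$ is the last update time of $p_i$ that is $\le t$; $\bar x_i(t)=\frac{1}{t-\tau_i(t)}\int_{\tau_i(t)}^tx_i(s)ds$ (and $\bar x_i=x_i$ when $t=\tau_i(t)$). At an update time $t$ of good $i$: $p_i(t)=p_i(t^-)\big(1+\lambda\,\mathrm{median}\{-1,\frac{\bar x_i(t^-)-\tilde w_i(t)}{w_i},1\}\big)$, with $\lambda>0$. $\mathrm{span}(a,b,c)=\max-\min$ of $a,b,c$. Potential $\phi=\sum_i\phi_i$, $\phi_i=p_i\big[\mathrm{span}(x_i,\bar x_i,\tilde w_i)-\lambda\alpha_1(t-\tau_i)|\bar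 x_i-\tilde w_i|+\alpha_2|\tilde w_i-w_i|\big]$, with constants $\alpha_1,\alpha_2>0$. *)

theory Defs
  imports "HOL-Analysis.Analysis"
begin

text \<open>Goods are indexed by a finite type 'n. Prices at time t: p t :: 'n \<Rightarrow> real.
 Demand: x :: ('n \<Rightarrow> real) \<Rightarrow> 'n \<Rightarrow> real (a function of the price vector).
 Update times of good i: the set U i.\<close>

definition median3 :: "real \<Rightarrow> real \<Rightarrow> real \<Rightarrow> real" where
  "median3 a b c = max (min a b) (min (max a b) c)"

definition span3 :: "real \<Rightarrow> real \<Rightarrow> real \<Rightarrow> real" where
  "span3 a b c = max a (max b c) - min a (min b c)"

definition last_upd :: "real set \<Rightarrow> real \<Rightarrow> real" where
  "last_upd U t = Max (U \<inter> {0..t})"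

definition prev_upd :: "real set \<Rightarrow> real \<Rightarrow> real" where
  "prev_upd U t = Max (U \<inter> {0..<t})"

definition avg_on :: "(real \<Rightarrow> real) \<Rightarrow> real \<Rightarrow> real \<Rightarrow> real" where
  "avg_on f a b = (if b = a then f b else integral {a..b} f / (b - a))"

definition pos_prices :: "('n \<Rightarrow> real) set" where
  "pos_prices = {p. \<forall>i. 0 < p i}"

definition wtil :: "('n \<Rightarrow> real) \<Rightarrow> real \<Rightarrow> ('n \<Rightarrow> real \<Rightarrow> real) \<Rightarrow> ('n \<Rightarrow> real) \<Rightarrow> 'n \<Rightarrow> real \<Rightarrow> real" where
  "wtil w \<kappa> s sstar i t = w i + \<kappa> * (s i t - sstar i)"

definition xbar :: "(('n \<Rightarrow> real) \<Rightarrow> 'n \<Rightarrow> real) \<Rightarrow> (real \<Rightarrow> 'n \<Rightarrow> real) \<Rightarrow> ('n \<Rightarrow> real set) \<Rightarrow> 'n \<Rightarrow> real \<Rightarrow> real" where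
  "xbar x p U i t = avg_on (\<lambda>r. x (p r) i) (last_upd (U i) t) t"

definition phi :: "(('n::finite \<Rightarrow> real) \<Rightarrow> 'n \<Rightarrow> real) \<Rightarrow> (real \<Rightarrow> 'n \<Rightarrow> real) \<Rightarrow> ('n \<Rightarrow> real set)
    \<Rightarrow> ('n \<Rightarrow> real) \<Rightarrow> real \<Rightarrow> ('n \<Rightarrow> real \<Rightarrow> real) \<Rightarrow> ('n \<Rightarrow> real)
    \<Rightarrow> real \<Rightarrow> real \<Rightarrow> real \<Rightarrow> real \<Rightarrow> real" where
  "phi x p U w \<kappa> s sstar lam \<alpha>1 \<alpha>2 t =
     (\<Sum>i\<in>UNIV. p t i *
        (span3 (x (p t) i) (xbar x p U i t) (wtil w \<kappa> s sstar i t)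
         - lam * \<alpha>1 * (t - last_upd (U i) t) * \<bar>xbar x p U i t - wtil w \<kappa> s sstar i t\<bar>
         + \<alpha>2 * \<bar>wtil w \<kappa> s sstar i t - w i\<bar>))"

end

theory Submission
  imports Defs
begin

text \<open>Along a price-update-free interval each summand of the potential obeys an exact finite-step
  inequality: F(r) + (r - a) * dissipation(r) \<le> F(a), with the dissipation evaluated at the end of
  the step, as in the backward Euler scheme. The resulting factors satisfy
  (1 + \<rho>h)(1 + \<rho>k) \<ge> 1 + \<rho>(h + k), so over one day the potential shrinks by 1 + \<rho>, and
  1 / (1 + \<rho>) \<le> 1 - \<rho>/2 for \<rho> \<le> 1; no differentiation of the potential is needed.

  At an update instant the prices are replaced one good at a time. By fixed spending and WGS the total
  spending displaced on the other goods equals the change of spending on the repriced good, and the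
  elasticity bound shows that the summand of the repriced good drops by at least as much.\<close>

text \<open>The discount proportional to \<open>t - last_upd (U i) t\<close> makes a summand fall
  even where its span is stationary, for instance when the average already equals the demand. An
  update resets the elapsed time, so this credit is lost there and the repricing must pay it back.
  The conditions on the constants are the budgets for this. \<open>c4\<close> lets the averaging pay
  for the drift of the target demand. \<open>c1\<close> covers the lost discount when the new demand
  is still on the side of the target that caused the price change. \<open>c3\<close> covers it when
  the new demand ends on the far side, where the displaced spending counts twice. The factors 3/2
  and 4/3 come from \<open>wtil_close\<close>, which gives w \<le> 3/2 wt and wt \<le> 4/3 w. A
  second difficulty is that an update instant needs the hypotheses for the prices in force just
  before it, while the hypotheses at that instant speak of the new prices. They are recovered as
  left limits.\<close>

subsection \<open>Finite-step dissipation of a single good\<close>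

lemma span3_ge: "\<bar>a - b\<bar> \<le> span3 a b c" "\<bar>b - c\<bar> \<le> span3 a b c" "\<bar>a - c\<bar> \<le> span3 a b c"
  unfolding span3_def by (auto simp: max_def min_def)

lemma span3_lipschitz: "span3 a b c \<le> span3 a' b c + \<bar>a - a'\<bar>"
  unfolding span3_def by (auto simp: max_def min_def)

text \<open>Here the demand is the origin, \<open>e\<close> and \<open>e'\<close> are the average
  before and after the step, and \<open>y\<close> is a frozen target. Either the average lies
  outside the segment from demand to target and its motion towards the demand shrinks the span, or
  the span stays put and the growing discount does the work.\<close>

lemma averaging_step:
  fixes \<gamma> T h e e' y :: real
  assumes g: "0 \<le> \<gamma>" "\<gamma> \<le> 1/2" and T: "0 \<le> T" "0 < h" "T + h \<le> 1"
    and e': "(T + h) * e' = T * e"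
  shows "span3 0 e' y - \<gamma> * (T + h) * \<bar>e' - y\<bar> + \<gamma>/2 * h * span3 0 e' y
           \<le> span3 0 e y - \<gamma> * T * \<bar>e - y\<bar>"
proof -
  \<comment> \<open>Reflection at the demand reduces the claim to a nonnegative
    \<open>e\<close>.\<close>
  have main: "span3 0 e' y - \<gamma> * (T + h) * \<bar>e' - y\<bar> + \<gamma>/2 * h * span3 0 e' y
           \<le> span3 0 e y - \<gamma> * T * \<bar>e - y\<bar>"
    if e': "(T + h) * e' = T * e" and e0: "0 \<le> e" for e e' y :: real
  proof -
    have e'0: "0 \<le> e'" using e' e0 T by (metis add_nonneg_pos mult_nonneg_nonneg zero_le_mult_iff less_le_not_le)
    have d: "(T + h) * (e - e') = h * e" using e' by (simp add: algebra_simps)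
    have "0 \<le> e - e'" using d e0 T by (metis add_nonneg_pos mult_nonneg_nonneg zero_le_mult_iff less_le_not_le less_imp_le)
    hence le: "e' \<le> e" by simp
    have "h * e = (T + h) * (e - e')" using d by simp
    also have "\<dots> \<le> 1 * (e - e')" using T le by (intro mult_right_mono) auto
    finally have q: "h * e \<le> e - e'" by simp
    have gh: "0 \<le> \<gamma> * h" "\<gamma> * h \<le> h / 2" using g T by (auto intro!: mult_nonneg_nonneg mult_right_mono[of \<gamma> "1/2" h, simplified])
    have gT: "0 \<le> \<gamma> * T" "\<gamma> * T \<le> 1/2"
      using g T mult_mono[of \<gamma> "1/2" T 1] by auto
    \<comment> \<open>The time-weighted gap changes linearly, by \<open>- h * y\<close>. If the
      target is beyond the average, the span is constant and this term alone supplies the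
      dissipation.\<close>
    have A1: "(T + h) * (e' - y) = T * (e - y) - h * y" using e' by (simp add: algebra_simps)
    have A1': "\<gamma> * (T + h) * (e' - y) = \<gamma> * T * (e - y) - \<gamma> * h * y"
      using arg_cong[OF A1, of "\<lambda>z. \<gamma> * z"] by (simp add: algebra_simps)
    have ghe: "\<gamma> * h * e \<le> h * e / 2" using gh(2) e0 mult_right_mono by fastforce
    have ghe': "\<gamma> * h * e' \<le> \<gamma> * h * e" using gh(1) le by (rule mult_left_mono[rotated])
    have ghe0: "0 \<le> \<gamma> * h * e'" using gh e'0 by simp
    consider "y \<le> 0" | "0 \<le> y" "y \<le> e'" | "e' \<le> y" "y \<le> e" | "e \<le> y" by linarith
    then show ?thesis
    proof cases
      case 1
      have s: "span3 0 e' y = e' - y" "span3 0 e y = e - y" "\<bar>e' - y\<bar> = e' - y" "\<bar>e - y\<bar> = e - y"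
        using 1 e0 e'0 by (auto simp: span3_def max_def min_def)
      have "\<gamma> * h * y \<le> 0" using gh 1 by (simp add: mult_nonneg_nonpos)
      moreover have "\<gamma>/2 * h * (e' - y) = \<gamma> * h * e' / 2 - \<gamma> * h * y / 2"
        by (simp add: field_simps)
      ultimately show ?thesis unfolding s A1' using ghe ghe' ghe0 q e0 e'0 by linarith
    next
      case 2
      have s: "span3 0 e' y = e'" "span3 0 e y = e" "\<bar>e' - y\<bar> = e' - y" "\<bar>e - y\<bar> = e - y"
        using 2 le by (auto simp: span3_def max_def min_def)
      have "\<gamma> * h * y \<le> \<gamma> * h * e" using gh 2 le by (intro mult_left_mono) auto
      moreover have "0 \<le> h * e" using T e0 by simp
      ultimately show ?thesis unfolding s A1' using ghe ghe' q by simp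
    next
      case 3
      have s: "span3 0 e' y = y" "span3 0 e y = e" "\<bar>e' - y\<bar> = -(e' - y)" "\<bar>e - y\<bar> = e - y"
        using 3 e'0 by (auto simp: span3_def max_def min_def)
      have "\<gamma> * T * (e - y) \<le> 1/2 * (e - y)" using gT 3 by (intro mult_right_mono) auto
      moreover have "0 \<le> \<gamma> * h * y" using gh 3 e'0 by simp
      ultimately show ?thesis unfolding s mult_minus_right A1' by (simp add: algebra_simps)
    next
      case 4
      have s: "span3 0 e' y = y" "span3 0 e y = y" "\<bar>e' - y\<bar> = -(e' - y)" "\<bar>e - y\<bar> = -(e - y)"
        using 4 le e'0 by (auto simp: span3_def max_def min_def)
      have "0 \<le> \<gamma> * h * y" using gh 4 e0 by simp
      thus ?thesis unfolding s mult_minus_right A1' by (simp add: algebra_simps)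
    qed
  qed
  have neg: "span3 0 (-a) (-b) = span3 0 a b" "\<bar>- a - (-b)\<bar> = \<bar>a - b\<bar>" for a b :: real
    by (auto simp: span3_def max_def min_def)
  show ?thesis
  proof (cases "0 \<le> e")
    case True
    thus ?thesis using main e' by blast
  next
    case False
    have "(T + h) * (- e') = T * (- e)" using e' by simp
    from main[OF this, of "-y"] False show ?thesis unfolding neg by simp
  qed
qed

text \<open>Monotonicity of a piecewise linear function of the target, the \<open>f\<close> below.
  With \<open>r\<close> and \<open>c\<close> as defined there, its slope is \<open>r - c\<close>
  left of both 0 and \<open>e\<close>, at least \<open>1 - r\<close> between them, and
  \<open>2 + c - r\<close> to the right; all are nonnegative.\<close>

lemma target_shift_step:
  fixes \<gamma> T h e y k :: real
  assumes g: "0 \<le> \<gamma>" "\<gamma> \<le> 1/2" and T: "0 \<le> T" "0 < h" "T + h \<le> 1" and k: "0 \<le> k"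
  shows "span3 0 e (y - k) - \<gamma> * (T + h) * \<bar>e - (y - k)\<bar> + \<gamma>/2 * h * span3 0 e (y - k)
           \<le> span3 0 e y - \<gamma> * (T + h) * \<bar>e - y\<bar> + \<gamma>/2 * h * span3 0 e y + k"
proof -
  define r where "r = \<gamma> * (T + h)"
  define c where "c = \<gamma>/2 * h"
  have r: "0 \<le> r" "r \<le> 1/2" using g T mult_mono[of \<gamma> "1/2" "T + h" 1] by (auto simp: r_def)
  have c0: "0 \<le> c" using g T by (auto simp: c_def)
  have "\<gamma> * h \<le> r" unfolding r_def using g T by (intro mult_left_mono) auto
  hence c: "2 * c \<le> r" by (simp add: c_def)
  define f where "f = (\<lambda>y. (1 + c) * span3 0 e y - r * \<bar>e - y\<bar> + y)"
  have r1: "r * z \<le> z" "c * z \<le> r * z" "0 \<le> r * z" "0 \<le> c * z" if "0 \<le> z" for z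
    using that r c c0 mult_right_mono[of r 1 z] mult_right_mono[of c r z] by auto
  have low: "f y \<le> f y'" if "y \<le> y'" "y' \<le> min 0 e" for y y'
  proof -
    have "y \<le> 0" "y \<le> e" "y' \<le> 0" "y' \<le> e" using that by auto
    hence s: "span3 0 e y = max 0 e - y" "span3 0 e y' = max 0 e - y'" "\<bar>e - y\<bar> = e - y" "\<bar>e - y'\<bar> = e - y'"
      by (auto simp: span3_def max_def min_def)
    show ?thesis unfolding f_def s using r1[of "y' - y"] that by (simp add: algebra_simps)
  qed
  have mid: "f y \<le> f y'" if "y \<le> y'" "min 0 e \<le> y" "y' \<le> max 0 e" for y y'
  proof -
    have s: "span3 0 e y = span3 0 e y'"
      using that by (cases "0 \<le> e") (auto simp: span3_def)
    have "r * \<bar>e - y'\<bar> \<le> r * (\<bar>e - y\<bar> + (y' - y))" using r that by (intro mult_left_mono) auto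
    thus ?thesis unfolding f_def s using r1[of "y' - y"] that by (simp add: algebra_simps)
  qed
  have high: "f y \<le> f y'" if "y \<le> y'" "max 0 e \<le> y" for y y'
  proof -
    have "0 \<le> y" "e \<le> y" "0 \<le> y'" "e \<le> y'" using that by auto
    hence s: "span3 0 e y = y - min 0 e" "span3 0 e y' = y' - min 0 e" "\<bar>e - y\<bar> = y - e" "\<bar>e - y'\<bar> = y' - e"
      by (auto simp: span3_def max_def min_def)
    show ?thesis unfolding f_def s using r1[of "y' - y"] that by (simp add: algebra_simps)
  qed
  have "f (y - k) \<le> f y"
  proof -
    \<comment> \<open>The path from \<open>y - k\<close> to \<open>y\<close> is cut at the two kinks
      of \<open>f\<close>; the cut points are clipped to the path, so pieces may be trivial.\<close>
    define a where "a = min y (max (y - k) (min 0 e))"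
    define b where "b = min y (max (y - k) (max 0 e))"
    have "f (y - k) \<le> f a"
    proof (cases "y - k \<le> min 0 e")
      case True
      have "y - k \<le> a" "a \<le> min 0 e" using True k unfolding a_def by linarith+
      thus ?thesis by (rule low)
    next
      case False
      hence "a = y - k" using k unfolding a_def by linarith
      thus ?thesis by simp
    qed
    also have "f a \<le> f b"
      using mid[of a b] k by (cases "a = b") (auto simp: a_def b_def min_def max_def split: if_splits)
    also have "f b \<le> f y" using high[of b y] k by (cases "b = y") (auto simp: b_def min_def max_def split: if_splits)
    finally show ?thesis .
  qed
  thus ?thesis
    unfolding r_def[symmetric] c_def[symmetric] f_def by (simp add: algebra_simps)
qed

text \<open>Coordinates are centred at the supply rate: \<open>u\<close>, \<open>b\<close>,
  \<open>v\<close> are demand, average and target minus \<open>w\<close>. The step is split into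
  averaging with frozen target, followed by the shift of the target by
  \<open>\<kappa> * u * h\<close>.\<close>

lemma flow_step_nonneg:
  fixes \<gamma> \<kappa> a T h u b b' v v' :: real
  assumes g: "0 < \<gamma>" "\<gamma> \<le> 1/2" and T: "0 \<le> T" "0 < h" "T + h \<le> 1"
    and kap: "0 < \<kappa>" "4 * \<kappa> * (1 + a) \<le> \<gamma>" and a: "1 < a" "a < 2"
    and b': "(T + h) * b' = T * b + h * u" and v': "v' = v - \<kappa> * u * h" and u: "0 \<le> u"
  shows "span3 u b' v' - \<gamma> * (T + h) * \<bar>b' - v'\<bar> + a * \<bar>v'\<bar> + \<gamma>/4 * h * span3 u b' v'
           + (if 0 < v' then (a - 1) * (\<kappa> * u * h) else 0)
           \<le> span3 u b v - \<gamma> * T * \<bar>b - v\<bar> + a * \<bar>v\<bar>"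
proof -
  define k where "k = \<kappa> * u * h"
  have k0: "0 \<le> k" using kap u T by (simp add: k_def)
  have tr: "span3 u c z = span3 0 (c - u) (z - u)" for c z
    by (auto simp: span3_def max_def min_def)
  have b'': "(T + h) * (b' - u) = T * (b - u)" using b' by (simp add: algebra_simps)
  have s1: "span3 u b' v - \<gamma> * (T + h) * \<bar>b' - v\<bar> + \<gamma>/2 * h * span3 u b' v
           \<le> span3 u b v - \<gamma> * T * \<bar>b - v\<bar>"
    unfolding tr using averaging_step[OF _ g(2) T b'', of "v - u"] g by simp
  have s2: "span3 u b' v' - \<gamma> * (T + h) * \<bar>b' - v'\<bar> + \<gamma>/2 * h * span3 u b' v'
           \<le> span3 u b' v - \<gamma> * (T + h) * \<bar>b' - v\<bar> + \<gamma>/2 * h * span3 u b' v + k"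
  proof -
    have "v - u - k = v' - u" "b' - u - (v' - u) = b' - v'" "b' - u - (v - u) = b' - v"
      using v' by (auto simp: k_def)
    thus ?thesis unfolding tr
      using target_shift_step[OF less_imp_le[OF g(1)] g(2) T k0, of "b' - u" "v - u"] by (simp only:)
  qed
  have gh: "0 \<le> \<gamma> * h" using g T by simp
  have s0: "0 \<le> span3 u b' v'" using span3_ge(1)[of u b' v'] by linarith
  have s0': "0 \<le> \<gamma> * h * span3 u b' v'" using gh s0 by simp
  have vk: "v' = v - k" by (simp add: v' k_def)
  show ?thesis
  \<comment> \<open>A target still above supply has moved towards it: the penalty releases
    \<open>a * k\<close>, the shift costs \<open>k\<close>, and \<open>(a - 1) * k\<close> remains.
    Otherwise the penalty may grow, at total cost \<open>(1 + a) * k\<close>; but then the span is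
    at least \<open>u\<close>, and half of the dissipation pays by 4\<kappa>(1 + a) \<le>
    \<gamma>.\<close>
  proof (cases "0 < v'")
    case True
    have "a * \<bar>v\<bar> = a * \<bar>v'\<bar> + a * k"
    proof -
      have "\<bar>v\<bar> = \<bar>v'\<bar> + k" using True vk k0 by simp
      thus ?thesis by (simp add: distrib_left)
    qed
    thus ?thesis using s1 s2 s0' True unfolding k_def[symmetric] by (simp add: algebra_simps)
  next
    case False
    have "a * \<bar>v'\<bar> \<le> a * (\<bar>v\<bar> + k)" using a vk k0 by (intro mult_left_mono) auto
    moreover have "\<gamma> * h * u \<le> \<gamma> * h * span3 u b' v'"
      using gh span3_ge(3)[of u v' b'] False by (intro mult_left_mono) auto
    moreover have "4 * \<kappa> * (1 + a) * (u * h) \<le> \<gamma> * (u * h)" using kap u T by (intro mult_right_mono) auto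
    ultimately show ?thesis using s1 s2 s0' False unfolding k_def[symmetric]
      by (simp add: algebra_simps k_def)
  qed
qed

lemma flow_step:
  fixes \<gamma> \<kappa> a T h x xb xb' wt wt' w :: real
  assumes g: "0 < \<gamma>" "\<gamma> \<le> 1/2" and T: "0 \<le> T" "0 < h" "T + h \<le> 1"
    and kap: "0 < \<kappa>" "4 * \<kappa> * (1 + a) \<le> \<gamma>" and a: "1 < a" "a < 2"
    and xb': "(T + h) * xb' = T * xb + h * x" and wt': "wt' = wt + \<kappa> * (w - x) * h"
  defines "F \<equiv> span3 x xb wt - \<gamma> * T * \<bar>xb - wt\<bar> + a * \<bar>wt - w\<bar>"
  defines "F' \<equiv> span3 x xb' wt' - \<gamma> * (T + h) * \<bar>xb' - wt'\<bar> + a * \<bar>wt' - w\<bar>"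
  shows "F' + h * (\<kappa> * (a - 1) / 2 * (span3 x xb' wt' + a * \<bar>wt' - w\<bar>)) \<le> F"
    and "F' + h * (\<gamma> / (2 * (1 + a)) * span3 x xb' wt') \<le> F"
proof -
  have tr: "span3 x c z = span3 (x - w) (c - w) (z - w)" "span3 x c z = span3 (w - x) (w - c) (w - z)"
     for c z by (auto simp: span3_def max_def min_def)
  define R where "R = (\<lambda>u v::real. if 0 < v then (a - 1) * (\<kappa> * u * h) else 0)"
  define S where "S = span3 x xb' wt'"
  \<comment> \<open>Demand above and below supply are mirror images; hiding the sign behind
    \<open>u\<close> and \<open>v\<close> lets both rates be derived once.\<close>
  have "\<exists>u v. 0 \<le> u \<and> \<bar>v\<bar> = \<bar>wt' - w\<bar> \<and> \<bar>u - v\<bar> = \<bar>x - wt'\<bar> \<and> F' + \<gamma>/4 * h * S + R u v \<le> F"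
  proof (cases "x \<ge> w")
    case True
    have 1: "(T + h) * (xb' - w) = T * (xb - w) + h * (x - w)" using xb' by (simp add: algebra_simps)
    have 2: "wt' - w = (wt - w) - \<kappa> * (x - w) * h" by (simp add: wt' algebra_simps)
    have "F' + \<gamma>/4 * h * S + R (x - w) (wt' - w) \<le> F"
      using flow_step_nonneg[OF g T kap a 1 2] True
      unfolding F_def F'_def S_def R_def tr(1) by simp
    with True show ?thesis by (intro exI[of _ "x - w"] exI[of _ "wt' - w"]) auto
  next
    case False
    have 1: "(T + h) * (w - xb') = T * (w - xb) + h * (w - x)" using xb' by (simp add: algebra_simps)
    have 2: "w - wt' = (w - wt) - \<kappa> * (w - x) * h" by (simp add: wt' algebra_simps)
    have "F' + \<gamma>/4 * h * S + R (w - x) (w - wt') \<le> F"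
      using flow_step_nonneg[OF g T kap a 1 2] False
      unfolding F_def F'_def S_def R_def tr(2) by (simp add: abs_minus_commute)
    with False show ?thesis by (intro exI[of _ "w - x"] exI[of _ "w - wt'"]) auto
  qed
  then obtain u v where u: "0 \<le> u" and v: "\<bar>v\<bar> = \<bar>wt' - w\<bar>" and uv: "\<bar>u - v\<bar> = \<bar>x - wt'\<bar>"
    and le: "F' + \<gamma>/4 * h * S + R u v \<le> F" by blast
  have S: "\<bar>u - v\<bar> \<le> S" unfolding uv S_def using span3_ge(3) by blast
  have S0: "0 \<le> S" using S by linarith
  have R0: "0 \<le> R u v" using a kap u T by (simp add: R_def)
  have th: "\<gamma> / (2 * (1 + a)) \<le> \<gamma> / 4" using a g by (intro divide_left_mono) auto
  have "\<gamma> / (2 * (1 + a)) * S \<le> \<gamma> / 4 * S" using th S0 by (rule mult_right_mono)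
  hence "h * (\<gamma> / (2 * (1 + a)) * S) \<le> h * (\<gamma> / 4 * S)" using T by (intro mult_left_mono) auto
  moreover have "h * (\<gamma> / 4 * S) = \<gamma> / 4 * h * S" by simp
  ultimately show "F' + h * (\<gamma> / (2 * (1 + a)) * span3 x xb' wt') \<le> F"
    using le R0 unfolding S_def[symmetric] by linarith
  have d: "\<kappa> * (a - 1) / 2 * ((1 + a) * S) \<le> \<gamma> / 4 * S"
  proof -
    have "\<kappa> * (a - 1) / 2 * (1 + a) \<le> \<kappa> * 1 / 2 * (1 + a)"
      using a kap by (intro mult_right_mono divide_right_mono mult_left_mono) auto
    also have "\<dots> \<le> \<gamma> / 4" using kap g by (simp add: field_simps)
    finally have "\<kappa> * (a - 1) / 2 * (1 + a) * S \<le> \<gamma> / 4 * S" using S0 by (rule mult_right_mono)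
    thus ?thesis by (simp add: mult.assoc)
  qed
  \<comment> \<open>The span alone need not control the penalty. For positive \<open>v\<close> one
    has v \<le> u + S, the span pays for \<open>S\<close>, and the surplus \<open>R\<close> pays for
    \<open>u\<close>, with a < 2 giving the factor 1/2 in the rate. For v \<le> 0 the span bounds
    the penalty by itself.\<close>
  have "h * (\<kappa> * (a - 1) / 2 * (S + a * \<bar>v\<bar>)) \<le> h * (\<gamma> / 4 * S) + R u v"
  proof (cases "0 < v")
    case True
    have "a * \<bar>v\<bar> \<le> a * (u + S)" using S True a by (intro mult_left_mono) auto
    also have "\<dots> \<le> 2 * u + a * S"
      using mult_right_mono[OF less_imp_le[OF a(2)] u] by (simp add: algebra_simps)
    finally have "\<kappa> * (a - 1) / 2 * (S + a * \<bar>v\<bar>) \<le> \<kappa> * (a - 1) / 2 * ((1 + a) * S + 2 * u)"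
      using a kap by (intro mult_left_mono) (auto simp: algebra_simps)
    also have "\<dots> = \<kappa> * (a - 1) / 2 * ((1 + a) * S) + (a - 1) * (\<kappa> * u)" by (simp add: field_simps)
    also have "\<dots> \<le> \<gamma> / 4 * S + (a - 1) * (\<kappa> * u)" using d by simp
    finally have "h * (\<kappa> * (a - 1) / 2 * (S + a * \<bar>v\<bar>)) \<le> h * (\<gamma> / 4 * S + (a - 1) * (\<kappa> * u))"
      using T by (intro mult_left_mono) auto
    also have "\<dots> = h * (\<gamma> / 4 * S) + R u v" using True by (simp add: R_def algebra_simps)
    finally show ?thesis .
  next
    case False
    have "a * \<bar>v\<bar> \<le> a * S" using S False u a by (intro mult_left_mono) auto
    hence "\<kappa> * (a - 1) / 2 * (S + a * \<bar>v\<bar>) \<le> \<kappa> * (a - 1) / 2 * ((1 + a) * S)"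
      using a kap by (intro mult_left_mono) (auto simp: algebra_simps)
    also note d
    finally have "h * (\<kappa> * (a - 1) / 2 * (S + a * \<bar>v\<bar>)) \<le> h * (\<gamma> / 4 * S)"
      using T by (intro mult_left_mono) auto
    thus ?thesis using R0 by linarith
  qed
  moreover have "h * (\<gamma> / 4 * S) = \<gamma> / 4 * h * S" by simp
  ultimately show "F' + h * (\<kappa> * (a - 1) / 2 * (span3 x xb' wt' + a * \<bar>wt' - w\<bar>)) \<le> F"
    using le unfolding S_def[symmetric] v by linarith
qed

subsection \<open>Elasticity and the repricing of a single good\<close>

context
  fixes g :: "real \<Rightarrow> real" and E c1 c2 :: real
  assumes deriv: "\<And>c. c1 \<le> c \<Longrightarrow> c \<le> c2 \<Longrightarrow>
      \<exists>D. (g has_real_derivative D) (at c) \<and> g c / c \<le> - D \<and> - D \<le> E * g c / c"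
    and pos: "\<And>c. c1 \<le> c \<Longrightarrow> c \<le> c2 \<Longrightarrow> 0 < g c"
    and c1: "0 < c1" and c12: "c1 \<le> c2" and E: "1 \<le> E"
begin

lemma demand_antimono:
  assumes c: "c1 \<le> c" "c \<le> c2"
  shows "g c \<le> g c1"
proof (rule DERIV_nonpos_imp_nonincreasing[OF c(1)])
  fix z assume z: "c1 \<le> z" "z \<le> c"
  obtain D where "(g has_real_derivative D) (at z)" "g z / z \<le> - D" using deriv[of z] c z by auto
  moreover have "0 < g z / z" using pos[of z] z c c1 by simp
  ultimately show "\<exists>D. (g has_real_derivative D) (at z) \<and> D \<le> 0" by (intro exI[of _ D]) auto
qed

text \<open>Mean value theorem; since demand decreases, \<open>g z / z\<close> is largest at the
  left endpoint.\<close>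

lemma demand_drop: "g c1 - g c2 \<le> E * (g c1 / c1) * (c2 - c1)"
proof (cases "c1 = c2")
  case False
  hence lt: "c1 < c2" using c12 by simp
  have "\<forall>c. \<exists>D. c1 \<le> c \<longrightarrow> c \<le> c2 \<longrightarrow>
      (g has_real_derivative D) (at c) \<and> g c / c \<le> - D \<and> - D \<le> E * g c / c" using deriv by blast
  then obtain D where D: "\<And>c. c1 \<le> c \<Longrightarrow> c \<le> c2 \<Longrightarrow>
      (g has_real_derivative D c) (at c) \<and> - D c \<le> E * g c / c" by metis
  obtain z where z: "c1 < z" "z < c2" "g c2 - g c1 = (c2 - c1) * D z"
    using MVT2[OF lt, of g D] D by blast
  have "- D z \<le> E * (g z / z)" using D[of z] z by simp
  also have "\<dots> \<le> E * (g c1 / c1)"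
    using demand_antimono[of z] z pos[of z] c1 E by (intro mult_left_mono frac_le) auto
  finally have "(c2 - c1) * (- D z) \<le> (c2 - c1) * (E * (g c1 / c1))"
    using lt by (intro mult_left_mono) auto
  thus ?thesis using z(3) by (simp add: algebra_simps)
qed simp

text \<open>The derivative of spending is \<open>g c + c * D\<close>, and the elasticity bound keeps
  it above \<open>- (E - 1) * g c\<close>.\<close>

lemma spending_drop: "c1 * g c1 - c2 * g c2 \<le> (E - 1) * g c1 * (c2 - c1)"
proof (cases "c1 = c2")
  case False
  hence lt: "c1 < c2" using c12 by simp
  have "\<forall>c. \<exists>D. c1 \<le> c \<longrightarrow> c \<le> c2 \<longrightarrow>
      (g has_real_derivative D) (at c) \<and> g c / c \<le> - D \<and> - D \<le> E * g c / c" using deriv by blast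
  then obtain D where D: "\<And>c. c1 \<le> c \<Longrightarrow> c \<le> c2 \<Longrightarrow>
      (g has_real_derivative D c) (at c) \<and> - D c \<le> E * g c / c" by metis
  obtain z where z: "c1 < z" "z < c2" "c2 * g c2 - c1 * g c1 = (c2 - c1) * (1 * g z + D z * z)"
    using MVT2[OF lt, of "\<lambda>c. c * g c" "\<lambda>c. 1 * g c + D c * c"] D DERIV_mult[OF DERIV_ident] by blast
  have "- D z \<le> E * g z / z" using D[of z] z by simp
  hence "- (g z + D z * z) \<le> (E - 1) * g z" using z c1 by (simp add: field_simps)
  also have "\<dots> \<le> (E - 1) * g c1" using demand_antimono[of z] z E by (intro mult_left_mono) auto
  finally have "(c2 - c1) * (- (g z + D z * z)) \<le> (c2 - c1) * ((E - 1) * g c1)"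
    using lt by (intro mult_left_mono) auto
  thus ?thesis using z(3) by (simp add: algebra_simps)
qed simp

end

lemma median3_up: "0 \<le> z \<Longrightarrow> median3 (-1) z 1 = min 1 z" for z :: real
  by (auto simp: median3_def)

lemma median3_down: "z \<le> 0 \<Longrightarrow> median3 (-1) z 1 = - min 1 (- z)" for z :: real
  by (auto simp: median3_def)

text \<open>Here \<open>x\<close> is the demand before the update instant, \<open>y\<close> the
  demand when the turn of this good comes, \<open>y'\<close> the demand after its repricing. The
  last term on the left is the spending displaced onto the other goods;
  \<open>\<bar>y - x\<bar>\<close> is what earlier repricings have charged to this good.\<close>

lemma price_increase:
  fixes P y y' x xb wt w lam E \<alpha>1 \<alpha>2 d T m :: real
  assumes P: "0 < P" and y: "0 < y" "0 < y'" and w: "0 < w" "\<bar>wt - w\<bar> \<le> w / 3"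
    and m: "m = min 1 ((xb - wt) / w)" and up: "wt \<le> xb"
    and lo: "y * (1 - E * (lam * m)) \<le> y'"
    and sp: "P * y - P * (1 + lam * m) * y' \<le> (E - 1) * y * (P * (lam * m))"
    and x: "x \<le> d * wt" and T: "0 \<le> T" "T \<le> 1"
    and par: "0 < lam" "1 \<le> E" "0 < \<alpha>1" "1 < \<alpha>2" "\<alpha>2 < 2" "2 \<le> d"
    and c1: "\<alpha>2 / 2 + \<alpha>1 * max (3/2) (d - 1) \<le> 1"
    and c2: "lam * E < 1"
    and c3: "lam * \<alpha>1 + 4/3 * lam * (1 + 2 * E * d / (1 - lam * E) + \<alpha>2 / 2) \<le> 1"
    and c4: "lam * \<alpha>1 \<le> 1/2"
  shows "P * (1 + lam * m) * (\<bar>y' - wt\<bar> + \<alpha>2 * \<bar>wt - w\<bar>) + (P * y - P * (1 + lam * m) * y')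
     \<le> P * (span3 x xb wt + \<bar>y - x\<bar> - lam * \<alpha>1 * T * \<bar>xb - wt\<bar> + \<alpha>2 * \<bar>wt - w\<bar>)"
proof -
  define G where "G = lam * \<alpha>1 * (xb - wt)"
  have m0: "0 \<le> m" "m \<le> 1" using m up w by auto
  have lm0: "0 \<le> lam * m" using m0 par by simp
  have wt: "w \<le> 3/2 * wt" "wt \<le> 4/3 * w" "0 < wt" "\<bar>wt - w\<bar> \<le> wt / 2" using w by linarith+
  have mw: "m * w \<le> xb - wt" using m w by (simp add: min_def field_simps)
  have G: "lam * \<alpha>1 * T * \<bar>xb - wt\<bar> \<le> G"
    using up par T mult_left_mono[of T 1 "lam * \<alpha>1 * (xb - wt)"] by (simp add: G_def mult.commute mult.left_commute)
  have pen: "\<alpha>2 * \<bar>wt - w\<bar> \<le> \<alpha>2 / 2 * wt" using wt(4) par mult_left_mono[of "\<bar>wt - w\<bar>" "wt/2" \<alpha>2] by simp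
  have core: "(1 + lam * m) * \<bar>y' - wt\<bar> + (lam * m) * (\<alpha>2 * \<bar>wt - w\<bar>) + (y - (1 + lam * m) * y') + G
       \<le> span3 x xb wt + \<bar>y - x\<bar>"
  \<comment> \<open>With demand still at or above target, the new span and the displaced spending
    cancel in \<open>y'\<close>, leaving a gain of \<open>lam * m * wt\<close>. After paying for the
    penalty it must cover the lost discount \<open>G\<close>.\<close>
  proof (cases "wt \<le> y'")
    case True
    have lhs: "(1 + lam * m) * \<bar>y' - wt\<bar> + (y - (1 + lam * m) * y') = y - wt - lam * m * wt"
      using True by (simp add: algebra_simps)
    have "lam * m * (\<alpha>2 * \<bar>wt - w\<bar>) \<le> lam * m * (\<alpha>2 / 2 * wt)" using pen lm0 by (rule mult_left_mono)
    moreover have "G \<le> lam * m * wt * (1 - \<alpha>2/2) + (max x xb - x)"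
    \<comment> \<open>An unclipped step has xb - wt = m w, at most 3/2 m wt. A clipped one gives no
      such bound, so xb - wt is split at \<open>x\<close>: x - wt is at most (d - 1) wt, and xb - x
      is covered by the span. This is the origin of the maximum in \<open>c1\<close>.\<close>
    proof (cases "m = 1")
      case False
      hence me: "xb - wt = m * w" using m w by (auto simp: min_def field_simps split: if_splits)
      have "\<alpha>1 * (3/2) \<le> \<alpha>1 * max (3/2) (d - 1)" using par by (intro mult_left_mono) auto
      hence a: "\<alpha>1 * (3/2) \<le> 1 - \<alpha>2/2" using c1 by linarith
      have "\<alpha>1 * w \<le> \<alpha>1 * (3/2) * wt" using wt par by simp
      also have "\<dots> \<le> (1 - \<alpha>2/2) * wt" using a wt by (intro mult_right_mono) auto
      finally have "lam * m * (\<alpha>1 * w) \<le> lam * m * ((1 - \<alpha>2/2) * wt)" using lm0 by (rule mult_left_mono)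
      thus ?thesis by (simp add: G_def me algebra_simps)
    next
      case True
      have "\<alpha>1 * (d - 1) \<le> \<alpha>1 * max (3/2) (d - 1)" using par by (intro mult_left_mono) auto
      hence a: "\<alpha>1 * (d - 1) \<le> 1 - \<alpha>2/2" using c1 by linarith
      have "\<alpha>1 * (x - wt) \<le> \<alpha>1 * ((d - 1) * wt)" using x par by (intro mult_left_mono) (auto simp: algebra_simps)
      also have "\<dots> \<le> (1 - \<alpha>2/2) * wt" using mult_right_mono[OF a, of wt] wt by (simp add: mult.assoc)
      finally have 1: "lam * (\<alpha>1 * (x - wt)) \<le> lam * ((1 - \<alpha>2/2) * wt)" using par by (intro mult_left_mono) auto
      have "lam * \<alpha>1 * (xb - x) \<le> lam * \<alpha>1 * (max x xb - x)" using par by (intro mult_left_mono) auto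
      also have "\<dots> \<le> 1 * (max x xb - x)" using c4 by (intro mult_right_mono) auto
      finally have "lam * \<alpha>1 * (xb - x) \<le> max x xb - x" by simp
      with 1 show ?thesis using True by (simp add: G_def algebra_simps)
    qed
    moreover have "max x xb - wt \<le> span3 x xb wt" by (auto simp: span3_def max_def min_def)
    moreover have "lam * m * wt * (1 - \<alpha>2/2) = lam * m * wt - lam * m * (\<alpha>2 / 2 * wt)"
      by (simp add: algebra_simps)
    ultimately show ?thesis using lhs by linarith
  next
    \<comment> \<open>Demand ends below target, so the displaced spending enters twice. It is
      bounded through \<open>y\<close>, and y (1 - lam E) \<le> y' < wt bounds \<open>y\<close> by
      the target; the room comes from xb - wt, which is at least \<open>m * w\<close>.\<close>
    case False
    define s where "s = span3 x xb wt + \<bar>y - x\<bar>"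
    have sE: "0 < 1 - lam * E" using c2 by simp
    have "P * (y - (1 + lam * m) * y') \<le> P * ((E - 1) * y * (lam * m))"
      using sp by (simp add: algebra_simps)
    hence 1: "y - (1 + lam * m) * y' \<le> (E - 1) * y * (lam * m)"
      using P mult_le_cancel_left_pos by blast
    have lhs: "(1 + lam * m) * \<bar>y' - wt\<bar> + (y - (1 + lam * m) * y')
        = 2 * (y - (1 + lam * m) * y') + (wt - y) + lam * m * wt"
      using False by (simp add: algebra_simps)
    have "E * (lam * m) \<le> lam * E" using m0 par mult_left_mono[of m 1 "E * lam"] by (simp add: mult_ac)
    hence "y * (1 - lam * E) \<le> y * (1 - E * (lam * m))" using y by (intro mult_left_mono) auto
    also have "\<dots> \<le> wt" using lo False by linarith
    finally have yw: "y \<le> wt / (1 - lam * E)" using sE by (simp add: field_simps)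
    have "(E - 1) * y * (lam * m) \<le> E * (wt / (1 - lam * E)) * (lam * m)"
      using yw par y lm0 by (intro mult_right_mono mult_mono) auto
    also have "\<dots> = lam * m * wt * (E / (1 - lam * E))" by simp
    finally have 2: "(E - 1) * y * (lam * m) \<le> lam * m * wt * (E / (1 - lam * E))" .
    define K where "K = 1 + 2 * E * d / (1 - lam * E) + \<alpha>2 / 2"
    have "2 * (E / (1 - lam * E)) \<le> 2 * E * d / (1 - lam * E)"
      using par sE mult_left_mono[of 1 d "2 * E"] by (simp add: divide_right_mono)
    hence K: "1 + 2 * (E / (1 - lam * E)) + \<alpha>2 / 2 \<le> K" by (simp add: K_def)
    have K0: "0 \<le> K" using par sE by (simp add: K_def)
    have "lam * m * wt * (1 + 2 * (E / (1 - lam * E)) + \<alpha>2 / 2) \<le> lam * m * wt * K"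
      using K lm0 wt by (intro mult_left_mono) auto
    also have "\<dots> \<le> lam * m * (4/3 * w) * K" using wt lm0 K0 by (intro mult_right_mono mult_left_mono) auto
    also have "\<dots> = (4/3 * lam * K) * (m * w)" by simp
    also have "\<dots> \<le> (4/3 * lam * K) * (xb - wt)" using mw K0 par by (intro mult_left_mono) auto
    finally have "lam * m * wt * (1 + 2 * (E / (1 - lam * E)) + \<alpha>2 / 2) + G
        \<le> (lam * \<alpha>1 + 4/3 * lam * K) * (xb - wt)" by (simp add: G_def algebra_simps)
    also have "\<dots> \<le> 1 * (xb - wt)" using c3 up by (intro mult_right_mono) (auto simp: K_def)
    finally have 3: "lam * m * wt * (1 + 2 * (E / (1 - lam * E)) + \<alpha>2 / 2) + G \<le> xb - wt" by simp
    have "lam * m * (\<alpha>2 * \<bar>wt - w\<bar>) \<le> lam * m * (\<alpha>2 / 2 * wt)" using pen lm0 by (rule mult_left_mono)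
    moreover have "(xb - wt) + (wt - y) \<le> s" using up by (auto simp: s_def span3_def max_def min_def)
    moreover have "lam * m * wt * (1 + 2 * q + \<alpha>2 / 2)
        = lam * m * wt + 2 * (lam * m * wt * q) + lam * m * (\<alpha>2 / 2 * wt)" for q
      by (simp add: algebra_simps)
    note 3[unfolded this]
    moreover define R where "R = lam * m * wt * (E / (1 - lam * E))"
    moreover define Y where "Y = y - (1 + lam * m) * y'"
    moreover define B where "B = (1 + lam * m) * \<bar>y' - wt\<bar>"
    ultimately show ?thesis
      using lhs order.trans[OF 1 2] unfolding s_def[symmetric] R_def[symmetric] Y_def[symmetric] B_def[symmetric]
      by linarith
  qed
  have "P * ((1 + lam * m) * \<bar>y' - wt\<bar> + (lam * m) * (\<alpha>2 * \<bar>wt - w\<bar>) + (y - (1 + lam * m) * y') + lam * \<alpha>1 * T * \<bar>xb - wt\<bar>)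
       \<le> P * (span3 x xb wt + \<bar>y - x\<bar>)" using core G P by (intro mult_left_mono) auto
  thus ?thesis by (simp add: algebra_simps)
qed

text \<open>Mirror of the increase, except that spending is now bounded through the larger new
  demand \<open>y'\<close>. Controlling \<open>y'\<close> takes an upper bound on \<open>y\<close>
  itself, hence the extra hypothesis y \<le> x.\<close>

lemma price_decrease:
  fixes P y y' x xb wt w lam E \<alpha>1 \<alpha>2 d T m :: real
  assumes P: "0 < P" and y: "0 < y" "0 < y'" and w: "0 < w" "\<bar>wt - w\<bar> \<le> w / 3"
    and m: "m = min 1 ((wt - xb) / w)" and down: "xb \<le> wt" and xb: "0 \<le> xb"
    and sp: "P * (1 - lam * m) * y' - P * y \<le> (E - 1) * y' * (P * (lam * m))"
    and x: "x \<le> d * wt" and yx: "y \<le> x" and T: "0 \<le> T" "T \<le> 1"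
    and par: "0 < lam" "1 \<le> E" "0 < \<alpha>1" "1 < \<alpha>2" "\<alpha>2 < 2" "2 \<le> d"
    and c1: "\<alpha>2 / 2 + \<alpha>1 * max (3/2) (d - 1) \<le> 1"
    and c2: "lam * E < 1"
    and c3: "lam * \<alpha>1 + 4/3 * lam * (1 + 2 * E * d / (1 - lam * E) + \<alpha>2 / 2) \<le> 1"
  shows "P * (1 - lam * m) * (\<bar>y' - wt\<bar> + \<alpha>2 * \<bar>wt - w\<bar>) + (P * (1 - lam * m) * y' - P * y)
     \<le> P * (span3 x xb wt + \<bar>y - x\<bar> - lam * \<alpha>1 * T * \<bar>xb - wt\<bar> + \<alpha>2 * \<bar>wt - w\<bar>)"
proof -
  define G where "G = lam * \<alpha>1 * (wt - xb)"
  define s where "s = span3 x xb wt + \<bar>y - x\<bar>"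
  have m0: "0 \<le> m" "m \<le> 1" using m down w by auto
  have lm0: "0 \<le> lam * m" using m0 par by simp
  have wt: "w \<le> 3/2 * wt" "wt \<le> 4/3 * w" "0 < wt" using w by linarith+
  have mw: "m * w \<le> wt - xb" using m w by (simp add: min_def field_simps)
  have G: "lam * \<alpha>1 * T * \<bar>xb - wt\<bar> \<le> G"
    using down par T mult_left_mono[of T 1 "lam * \<alpha>1 * (wt - xb)"] by (simp add: G_def mult.commute mult.left_commute)
  have pen: "(1 - lam * m) * (\<alpha>2 * \<bar>wt - w\<bar>) \<le> 1 * (\<alpha>2 * \<bar>wt - w\<bar>)"
    using lm0 par by (intro mult_right_mono) auto
  have core: "(1 - lam * m) * \<bar>y' - wt\<bar> + ((1 - lam * m) * y' - y) + G \<le> s"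
  proof (cases "y' \<le> wt")
    case True
    have lhs: "(1 - lam * m) * \<bar>y' - wt\<bar> + ((1 - lam * m) * y' - y) = wt - y - lam * m * wt"
      using True by (simp add: algebra_simps)
    have "\<alpha>1 * (3/2) \<le> \<alpha>1 * max (3/2) (d - 1)" using par by (intro mult_left_mono) auto
    hence a: "\<alpha>1 * (3/2) \<le> 1" using c1 par by linarith
    have "\<alpha>1 * (wt - xb) \<le> m * wt"
    proof (cases "m = 1")
      case False
      hence me: "wt - xb = m * w" using m w by (auto simp: min_def field_simps split: if_splits)
      have "\<alpha>1 * w \<le> \<alpha>1 * (3/2) * wt" using wt par by simp
      also have "\<dots> \<le> 1 * wt" using a wt by (intro mult_right_mono) auto
      finally have "m * (\<alpha>1 * w) \<le> m * wt" using m0 by (intro mult_left_mono) auto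
      thus ?thesis by (simp add: me algebra_simps)
    next
      case True
      \<comment> \<open>For a clipped decrease the gap is at most \<open>wt\<close> merely because
        averages are nonnegative.\<close>
      have "\<alpha>1 * (wt - xb) \<le> 1 * wt" using a par xb down by (intro mult_mono) auto
      thus ?thesis using True by simp
    qed
    hence "lam * (\<alpha>1 * (wt - xb)) \<le> lam * (m * wt)" using par by (intro mult_left_mono) auto
    moreover have "wt - y \<le> s" by (auto simp: s_def span3_def max_def min_def)
    ultimately show ?thesis using lhs by (simp add: G_def algebra_simps)
  next
    case False
    have sE: "0 < 1 - lam * E" using c2 by simp
    have "P * ((1 - lam * m) * y' - y) \<le> P * ((E - 1) * y' * (lam * m))"
      using sp by (simp add: algebra_simps)
    hence 1: "(1 - lam * m) * y' - y \<le> (E - 1) * y' * (lam * m)"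
      using P mult_le_cancel_left_pos by blast
    have lhs: "(1 - lam * m) * \<bar>y' - wt\<bar> + ((1 - lam * m) * y' - y)
        = 2 * ((1 - lam * m) * y' - y) + (y - wt) + lam * m * wt"
      using False by (simp add: algebra_simps)
    \<comment> \<open>The spending bound, read as an inequality for \<open>y'\<close>, gives y' (1 -
      lam E) \<le> y \<le> d wt; this produces the term 2Ed/(1 - lam E) in
      \<open>c3\<close>.\<close>
    have "E * (lam * m) \<le> lam * E" using m0 par mult_left_mono[of m 1 "E * lam"] by (simp add: mult_ac)
    hence "y' * (1 - lam * E) \<le> y' * (1 - E * (lam * m))" using y by (intro mult_left_mono) auto
    also have "\<dots> \<le> y" using 1 by (simp add: algebra_simps)
    finally have yw: "y' \<le> y / (1 - lam * E)" using sE by (simp add: field_simps)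
    have "y \<le> d * wt" using yx x by simp
    hence "y / (1 - lam * E) \<le> d * wt / (1 - lam * E)" using sE by (intro divide_right_mono) auto
    with yw have yw: "y' \<le> d * wt / (1 - lam * E)" by simp
    have "(E - 1) * y' * (lam * m) \<le> E * (d * wt / (1 - lam * E)) * (lam * m)"
      using yw par y lm0 by (intro mult_right_mono mult_mono) auto
    also have "\<dots> = lam * m * wt * (E * d / (1 - lam * E))" by simp
    finally have 2: "(E - 1) * y' * (lam * m) \<le> lam * m * wt * (E * d / (1 - lam * E))" .
    define K where "K = 1 + 2 * E * d / (1 - lam * E) + \<alpha>2 / 2"
    have K: "1 + 2 * (E * d / (1 - lam * E)) \<le> K" using par by (simp add: K_def)
    have K0: "0 \<le> K" using par sE by (simp add: K_def)
    have "lam * m * wt * (1 + 2 * (E * d / (1 - lam * E))) \<le> lam * m * wt * K"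
      using K lm0 wt by (intro mult_left_mono) auto
    also have "\<dots> \<le> lam * m * (4/3 * w) * K" using wt lm0 K0 by (intro mult_right_mono mult_left_mono) auto
    also have "\<dots> = (4/3 * lam * K) * (m * w)" by simp
    also have "\<dots> \<le> (4/3 * lam * K) * (wt - xb)" using mw K0 par by (intro mult_left_mono) auto
    finally have "lam * m * wt * (1 + 2 * (E * d / (1 - lam * E))) + G
        \<le> (lam * \<alpha>1 + 4/3 * lam * K) * (wt - xb)" by (simp add: G_def algebra_simps)
    also have "\<dots> \<le> 1 * (wt - xb)" using c3 down by (intro mult_right_mono) (auto simp: K_def)
    finally have 3: "lam * m * wt * (1 + 2 * (E * d / (1 - lam * E))) + G \<le> wt - xb" by simp
    have "(wt - xb) + (y - wt) \<le> s" using down by (auto simp: s_def span3_def max_def min_def)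
    moreover have "lam * m * wt * (1 + 2 * q) = lam * m * wt + 2 * (lam * m * wt * q)" for q
      by (simp add: algebra_simps)
    note 3[unfolded this]
    moreover define R where "R = lam * m * wt * (E * d / (1 - lam * E))"
    moreover define Y where "Y = (1 - lam * m) * y' - y"
    moreover define B where "B = (1 - lam * m) * \<bar>y' - wt\<bar>"
    ultimately show ?thesis
      using lhs order.trans[OF 1 2] unfolding R_def[symmetric] Y_def[symmetric] B_def[symmetric] by linarith
  qed
  have "P * ((1 - lam * m) * \<bar>y' - wt\<bar> + (1 - lam * m) * (\<alpha>2 * \<bar>wt - w\<bar>) + ((1 - lam * m) * y' - y)
          + lam * \<alpha>1 * T * \<bar>xb - wt\<bar>)
       \<le> P * (s + \<alpha>2 * \<bar>wt - w\<bar>)" using core G pen P by (intro mult_left_mono) auto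
  thus ?thesis by (simp add: s_def algebra_simps)
qed

section \<open>Left limits and the composition of decay factors\<close>

lemma nonneg_at_right_endpoint:
  fixes f :: "real \<Rightarrow> real"
  assumes "continuous_on {a..b} f" "a < b" "\<And>r. a \<le> r \<Longrightarrow> r < b \<Longrightarrow> 0 \<le> f r"
  shows "0 \<le> f b"
proof -
  have cl: "closure {a..<b} = {a..b}" using assms(2) by simp
  show ?thesis
    by (rule continuous_ge_on_closure[of "{a..<b}" f b 0]) (use assms cl in auto)
qed

text \<open>Induction on the number of points of \<open>V\<close>, splitting at the first interior
  one. Nonnegativity of \<open>f\<close> allows the inequality between the factors to be multiplied
  by \<open>f t1\<close>.\<close>

lemma decay_compose:
  fixes f :: "real \<Rightarrow> real" and V :: "real set"
  assumes "finite (V \<inter> {t0<..t1})" and \<rho>: "0 \<le> \<rho>" and "t0 \<le> t1"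
    and "\<And>r. t0 \<le> r \<Longrightarrow> r \<le> t1 \<Longrightarrow> 0 \<le> f r"
    and "\<And>a b. t0 \<le> a \<Longrightarrow> a < b \<Longrightarrow> b \<le> t1 \<Longrightarrow> V \<inter> {a<..<b} = {} \<Longrightarrow> (1 + \<rho> * (b - a)) * f b \<le> f a"
  shows "(1 + \<rho> * (t1 - t0)) * f t1 \<le> f t0"
  using assms(1,3-5)
proof (induction "card (V \<inter> {t0<..t1})" arbitrary: t0 rule: less_induct)
  case less
  show ?case
  proof (cases "V \<inter> {t0<..<t1} = {}")
    case True
    show ?thesis
    proof (cases "t0 = t1")
      case False
      thus ?thesis using less.prems True by simp
    qed simp
  next
    case False
    define b where "b = Min (V \<inter> {t0<..<t1})"
    have fin: "finite (V \<inter> {t0<..<t1})" using less.prems(1) by (rule rev_finite_subset) auto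
    have b: "b \<in> V" "t0 < b" "b < t1" using Min_in[OF fin False] by (auto simp: b_def)
    have "\<And>v. v \<in> V \<inter> {t0<..<t1} \<Longrightarrow> b \<le> v" using fin by (simp add: b_def)
    hence e: "V \<inter> {t0<..<b} = {}" using b by force
    have 1: "(1 + \<rho> * (b - t0)) * f b \<le> f t0" using less.prems(4)[of t0 b] b e by simp
    have "V \<inter> {b<..t1} \<subset> V \<inter> {t0<..t1}" using b by auto
    hence c: "card (V \<inter> {b<..t1}) < card (V \<inter> {t0<..t1})" using less.prems(1) by (rule psubset_card_mono[rotated])
    have 2: "(1 + \<rho> * (t1 - b)) * f t1 \<le> f b"
    proof (rule less.hyps[OF c])
      show "finite (V \<inter> {b<..t1})" using less.prems(1) by (rule rev_finite_subset) (use b in auto)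
      show "0 \<le> f r" if "b \<le> r" "r \<le> t1" for r using that less.prems(3)[of r] b by simp
      show "(1 + \<rho> * (bb - a)) * f bb \<le> f a"
        if "b \<le> a" "a < bb" "bb \<le> t1" "V \<inter> {a<..<bb} = {}" for a bb
        using that less.prems(4)[of a bb] b by simp
    qed (use b in simp)
    have ft: "0 \<le> f t1" using less.prems by simp
    have pos: "0 \<le> \<rho> * (b - t0)" "0 \<le> \<rho> * (t1 - b)" using \<rho> b by auto
    have "(1 + \<rho> * (t1 - t0)) * f t1 \<le> ((1 + \<rho> * (b - t0)) * (1 + \<rho> * (t1 - b))) * f t1"
    proof (intro mult_right_mono ft)
      have "0 \<le> \<rho> * (b - t0) * (\<rho> * (t1 - b))" using pos by (rule mult_nonneg_nonneg)
      thus "1 + \<rho> * (t1 - t0) \<le> (1 + \<rho> * (b - t0)) * (1 + \<rho> * (t1 - b))" by (simp add: algebra_simps)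
    qed
    also have "\<dots> \<le> (1 + \<rho> * (b - t0)) * f b"
      unfolding mult.assoc using 2 pos by (intro mult_left_mono) auto
    finally show ?thesis using 1 by simp
  qed
qed

lemma backward_euler_rate:
  fixes \<rho> F G :: real
  assumes "(1 + \<rho>) * G \<le> F" "0 \<le> \<rho>" "\<rho> \<le> 1" "0 \<le> F"
  shows "G \<le> (1 - \<rho> / 2) * F"
proof -
  have "0 \<le> \<rho> * (1 - \<rho>)" using assms by simp
  hence "1 \<le> (1 + \<rho>) * (1 - \<rho> / 2)" by (simp add: algebra_simps power2_eq_square)
  from mult_right_mono[OF this assms(4)]
  have "F \<le> (1 + \<rho>) * ((1 - \<rho> / 2) * F)" by (simp only: mult.assoc mult_1_left)
  with assms(1) have "(1 + \<rho>) * G \<le> (1 + \<rho>) * ((1 - \<rho> / 2) * F)" by (rule order.trans)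
  thus ?thesis using assms(2) by (simp add: mult_le_cancel_left_pos)
qed

subsection \<open>The market between updates\<close>

locale warehouse_market =
  fixes x :: "('n::finite \<Rightarrow> real) \<Rightarrow> 'n \<Rightarrow> real"
    and w :: "'n \<Rightarrow> real" and M :: real
    and p :: "real \<Rightarrow> 'n \<Rightarrow> real"
    and U :: "'n \<Rightarrow> real set"
    and s :: "'n \<Rightarrow> real \<Rightarrow> real" and sstar :: "'n \<Rightarrow> real"
    and \<kappa> lam E d \<alpha>1 \<alpha>2 :: real
  assumes w_pos: "\<And>i. 0 < w i"
    and x_pos: "\<And>q i. q \<in> pos_prices \<Longrightarrow> 0 < x q i"
    and fixed_spending: "\<And>q. q \<in> pos_prices \<Longrightarrow> (\<Sum>i\<in>UNIV. q i * x q i) = M"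
    and WGS: "\<And>q i j c. q \<in> pos_prices \<Longrightarrow> j \<noteq> i \<Longrightarrow> q i \<le> c \<Longrightarrow> x q j \<le> x (q(i := c)) j"
    and elasticity: "\<And>q i. q \<in> pos_prices \<Longrightarrow> \<exists>D.
           ((\<lambda>c. x (q(i := c)) i) has_real_derivative D) (at (q i))
           \<and> x q i / q i \<le> - D \<and> - D \<le> E * x q i / q i"
    and E_ge: "1 \<le> E"
    and kappa_pos: "0 < \<kappa>" and lambda_pos: "0 < lam"
    and alpha1_pos: "0 < \<alpha>1"
    and U_nonneg: "\<And>i. U i \<subseteq> {0..}"
    and U_zero: "\<And>i. 0 \<in> U i"
    and U_finite: "\<And>i t. finite (U i \<inter> {0..t})"
    and U_gap: "\<And>i u. u \<in> U i \<Longrightarrow> \<exists>v\<in>U i. u < v \<and> v \<le> u + 1"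
    and p0_pos: "p 0 \<in> pos_prices"
    and p_const: "\<And>i t. 0 \<le> t \<Longrightarrow> p t i = p (last_upd (U i) t) i"
    and stock: "\<And>i t. 0 \<le> t \<Longrightarrow>
        ((\<lambda>r. w i - x (p r) i) has_integral (s i t - s i 0)) {0..t}"
    and update: "\<And>i t. t \<in> U i \<Longrightarrow> 0 < t \<Longrightarrow>
        p t i = p (prev_upd (U i) t) i *
          (1 + lam * median3 (-1)
                 ((avg_on (\<lambda>r. x (p r) i) (prev_upd (U i) t) t - wtil w \<kappa> s sstar i t) / w i) 1)"
    and wtil_close: "\<And>i t. 0 \<le> t \<Longrightarrow> \<bar>wtil w \<kappa> s sstar i t - w i\<bar> \<le> w i / 3"
    and x_le: "\<And>i t. 0 \<le> t \<Longrightarrow> x (p t) i \<le> d * wtil w \<kappa> s sstar i t"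
    and d_ge: "2 \<le> d"
    and a2_range: "1 < \<alpha>2" "\<alpha>2 < 2"
    and c1: "\<alpha>2 / 2 + \<alpha>1 * max (3/2) (d - 1) \<le> 1"
    and c2: "lam * E < 1"
    and c3: "lam * \<alpha>1 + 4/3 * lam * (1 + 2 * E * d / (1 - lam * E) + \<alpha>2 / 2) \<le> 1"
    and c4: "4 * \<kappa> * (1 + \<alpha>2) \<le> lam * \<alpha>1" "lam * \<alpha>1 \<le> 1/2"
begin

section \<open>Update times, positivity of prices and stock accounting\<close>

lemma lam_lt_1: "lam < 1"
  using c2 mult_left_mono[OF E_ge, of lam] lambda_pos by linarith

lemma last_upd_in:
  assumes "0 \<le> t"
  shows "last_upd (U i) t \<in> U i \<inter> {0..t}"
proof -
  have "0 \<in> U i \<inter> {0..t}" using U_zero assms by simp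
  thus ?thesis unfolding last_upd_def using U_finite by (intro Max_in) auto
qed

lemma last_upd_ge: "u \<in> U i \<Longrightarrow> u \<le> t \<Longrightarrow> u \<le> last_upd (U i) t"
  unfolding last_upd_def using U_finite U_nonneg[of i] by (intro Max_ge) auto

lemma last_upd_eq:
  assumes "0 \<le> a" "a \<le> t" "U i \<inter> {a<..t} = {}"
  shows "last_upd (U i) t = last_upd (U i) a"
proof -
  have "U i \<inter> {0..t} = U i \<inter> {0..a}" using assms by force
  thus ?thesis by (simp add: last_upd_def)
qed

lemma prev_upd_eq:
  assumes "0 \<le> a" "a < t" "U i \<inter> {a<..<t} = {}"
  shows "prev_upd (U i) t = last_upd (U i) a"
proof -
  have "U i \<inter> {0..<t} = U i \<inter> {0..a}" using assms by force
  thus ?thesis by (simp add: last_upd_def prev_upd_def)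
qed

text \<open>Some update follows the last one within a day, and it cannot fall before
  \<open>b\<close>. This bounds the averaging window at the end of a step by 1.\<close>

lemma next_upd_le:
  assumes "0 \<le> a" "a < b" "U i \<inter> {a<..<b} = {}"
  shows "b \<le> last_upd (U i) a + 1"
proof -
  obtain v where v: "v \<in> U i" "last_upd (U i) a < v" "v \<le> last_upd (U i) a + 1"
    using U_gap last_upd_in[OF assms(1), of i] by blast
  have "a < v" using last_upd_ge[OF v(1), of a] v(2) by force
  hence "b \<le> v" using v(1) assms(3) by force
  thus ?thesis using v(3) by simp
qed

lemma elapsed: "0 \<le> t \<Longrightarrow> 0 \<le> t - last_upd (U i) t" "0 \<le> t \<Longrightarrow> t - last_upd (U i) t \<le> 1"
proof -
  assume t: "0 \<le> t"
  show "0 \<le> t - last_upd (U i) t" using last_upd_in[OF t, of i] by auto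
  obtain v where v: "v \<in> U i" "last_upd (U i) t < v" "v \<le> last_upd (U i) t + 1"
    using U_gap last_upd_in[OF t, of i] by blast
  thus "t - last_upd (U i) t \<le> 1" using last_upd_ge[OF v(1), of t] by force
qed

lemma median3_ge: "-1 \<le> median3 (-1) z 1"
  by (auto simp: median3_def)

text \<open>Induction on the number of earlier updates: each factor is at least 1 - lam, which is
  positive.\<close>

lemma price_pos_at_upd: "u \<in> U i \<Longrightarrow> 0 < p u i"
proof (induction "card (U i \<inter> {0..u})" arbitrary: u rule: less_induct)
  case less
  show ?case
  proof (cases "u = 0")
    case True
    thus ?thesis using p0_pos by (simp add: pos_prices_def)
  next
    case False
    hence u: "0 < u" using less.prems U_nonneg[of i] by force
    have fin: "finite (U i \<inter> {0..<u})" by (rule finite_subset[OF _ U_finite[of i u]]) auto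
    define v where "v = prev_upd (U i) u"
    have "0 \<in> U i \<inter> {0..<u}" using U_zero u by simp
    hence v: "v \<in> U i \<inter> {0..<u}" unfolding v_def prev_upd_def using fin by (intro Max_in) auto
    have "U i \<inter> {0..v} \<subset> U i \<inter> {0..u}" using v less.prems u by force
    hence "card (U i \<inter> {0..v}) < card (U i \<inter> {0..u})" by (rule psubset_card_mono[OF U_finite])
    hence "0 < p v i" using less.hyps v by blast
    moreover have "0 < 1 + lam * median3 (-1) z 1" for z
      using mult_left_mono[OF median3_ge[of z], of lam] lambda_pos lam_lt_1 by simp
    ultimately show ?thesis using update[OF less.prems u] unfolding v_def[symmetric] by simp
  qed
qed

lemma price_pos: "0 \<le> t \<Longrightarrow> 0 < p t i"
  using p_const[of t i] last_upd_in[of t i] price_pos_at_upd by auto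

lemma prices_pos: "0 \<le> t \<Longrightarrow> p t \<in> pos_prices"
  using price_pos by (simp add: pos_prices_def)

text \<open>Demand integrals are read off from the stock balance, so averages become explicit
  expressions in the stock and integrability comes for free.\<close>

lemma demand_integral:
  assumes "0 \<le> a" "a \<le> b"
  shows "((\<lambda>r. x (p r) i) has_integral (w i * (b - a) - (s i b - s i a))) {a..b}"
proof -
  define f where "f = (\<lambda>r. w i - x (p r) i)"
  have f: "(f has_integral (s i t - s i 0)) {0..t}" if "0 \<le> t" for t unfolding f_def using stock[OF that] .
  have ib: "f integrable_on {0..b}" using f[of b] assms by (auto simp: has_integral_integrable)
  have iab: "f integrable_on {a..b}" using ib by (rule integrable_subinterval_real) (use assms in auto)
  have "integral {0..a} f + integral {a..b} f = integral {0..b} f"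
    using assms ib by (intro Henstock_Kurzweil_Integration.integral_combine) auto
  hence "integral {a..b} f = s i b - s i a" using f[of a] f[of b] assms by (simp add: integral_unique)
  hence "(f has_integral (s i b - s i a)) {a..b}" using iab by (metis has_integral_integral)
  from has_integral_diff[OF has_integral_const_real[of "w i" a b] this]
  show ?thesis using assms by (simp add: f_def mult.commute)
qed

lemma avg_on_demand:
  assumes "0 \<le> a" "a < b"
  shows "avg_on (\<lambda>r. x (p r) i) a b = (w i * (b - a) - (s i b - s i a)) / (b - a)"
  using integral_unique[OF demand_integral[of a b i]] assms by (simp add: avg_on_def)

lemma avg_on_demand_nonneg:
  assumes "0 \<le> a" "a < b"
  shows "0 \<le> avg_on (\<lambda>r. x (p r) i) a b"
proof -
  have "0 \<le> integral {a..b} (\<lambda>r. x (p r) i)"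
    using demand_integral[of a b i] assms x_pos prices_pos
    by (intro integral_nonneg) (auto simp: has_integral_integrable intro!: less_imp_le)
  thus ?thesis using assms by (simp add: avg_on_def)
qed

text \<open>The interval is open on purpose: an update at \<open>a\<close> is already contained in
  \<open>p a\<close>, and one at \<open>b\<close> is treated separately as a jump.\<close>

definition quiet :: "real \<Rightarrow> real \<Rightarrow> bool" where
  "quiet a b \<longleftrightarrow> 0 \<le> a \<and> a < b \<and> (\<forall>i. U i \<inter> {a<..<b} = {})"

lemma quietD: "quiet a b \<Longrightarrow> 0 \<le> a" "quiet a b \<Longrightarrow> a < b" "quiet a b \<Longrightarrow> U i \<inter> {a<..<b} = {}"
  by (auto simp: quiet_def)

lemma quiet_last_upd: "quiet a b \<Longrightarrow> a \<le> r \<Longrightarrow> r < b \<Longrightarrow> last_upd (U i) r = last_upd (U i) a"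
  using quietD(1,2)[of a b] quietD(3)[of a b i] by (intro last_upd_eq) auto

lemma quiet_prices: "quiet a b \<Longrightarrow> a \<le> r \<Longrightarrow> r < b \<Longrightarrow> p r = p a"
  using quiet_last_upd p_const quietD(1) by (metis ext order.trans)

lemma quiet_stock:
  assumes q: "quiet a b" and r: "a \<le> r" "r \<le> b"
  shows "s i r = s i a + (r - a) * (w i - x (p a) i)"
proof -
  have "((\<lambda>t. x (p a) i) has_integral x (p a) i * (r - a)) {a..r}"
    using has_integral_const_real[of "x (p a) i" a r] r by (simp add: mult.commute)
  \<comment> \<open>Prices may already be new at \<open>r\<close> when \<open>r\<close> equals
    \<open>b\<close>; a single point does not affect the integral.\<close>
  hence "((\<lambda>t. x (p t) i) has_integral x (p a) i * (r - a)) {a..r}"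
  proof (rule has_integral_spike_finite[of "{r}", rotated 2])
    fix t assume "t \<in> {a..r} - {r}"
    hence "p t = p a" using r by (intro quiet_prices[OF q]) auto
    thus "x (p t) i = x (p a) i" by simp
  qed simp
  from has_integral_unique[OF this demand_integral[of a r i]] show ?thesis
    using r quietD(1)[OF q] by (simp add: algebra_simps)
qed

abbreviation wt :: "'n \<Rightarrow> real \<Rightarrow> real" where
  "wt \<equiv> wtil w \<kappa> s sstar"

lemma quiet_wt:
  assumes "quiet a b" "a \<le> r" "r \<le> b"
  shows "wt i r = wt i a + \<kappa> * (w i - x (p a) i) * (r - a)"
  unfolding wtil_def quiet_stock[OF assms, of i] by (simp add: algebra_simps)

definition pot :: "'n \<Rightarrow> real \<Rightarrow> real \<Rightarrow> real \<Rightarrow> real \<Rightarrow> real" where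
  "pot i y b v T = span3 y b v - lam * \<alpha>1 * T * \<bar>b - v\<bar> + \<alpha>2 * \<bar>v - w i\<bar>"

lemma pot_nonneg:
  assumes "0 \<le> T" "T \<le> 1"
  shows "0 \<le> pot i y b v T"
proof -
  have "lam * \<alpha>1 * T \<le> 1" using assms c4(2) lambda_pos alpha1_pos mult_mono[of "lam * \<alpha>1" 1 T 1] by simp
  hence "lam * \<alpha>1 * T * \<bar>b - v\<bar> \<le> 1 * \<bar>b - v\<bar>" by (rule mult_right_mono) simp
  also have "\<dots> \<le> span3 y b v" using span3_ge(2) by simp
  finally show ?thesis using a2_range by (simp add: pot_def)
qed

lemma pot_le:
  assumes "0 \<le> T"
  shows "pot i y b v T \<le> span3 y b v + \<alpha>2 * \<bar>v - w i\<bar>"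
  using assms lambda_pos alpha1_pos by (simp add: pot_def)

abbreviation Phi :: "real \<Rightarrow> real" where
  "Phi \<equiv> phi x p U w \<kappa> s sstar lam \<alpha>1 \<alpha>2"

lemma Phi_eq: "Phi t = (\<Sum>i\<in>UNIV. p t i * pot i (x (p t) i) (xbar x p U i t) (wt i t) (t - last_upd (U i) t))"
  by (simp add: phi_def pot_def)

lemma Phi_nonneg: "0 \<le> t \<Longrightarrow> 0 \<le> Phi t"
  unfolding Phi_eq using price_pos pot_nonneg elapsed
  by (intro sum_nonneg mult_nonneg_nonneg) (auto intro: less_imp_le)

text \<open>At an update time \<open>xbar\<close> restarts its window. Keeping the window that was
  open at \<open>a\<close> yields the average just before the update, which is the one the update
  rule reads.\<close>

definition avg_from :: "real \<Rightarrow> 'n \<Rightarrow> real \<Rightarrow> real" where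
  "avg_from a i r = avg_on (\<lambda>t. x (p t) i) (last_upd (U i) a) r"

text \<open>At the end of a quiet interval this is the left limit of the potential, before any
  price update there.\<close>
definition Phi_from :: "real \<Rightarrow> real \<Rightarrow> real" where
  "Phi_from a r = (\<Sum>i\<in>UNIV. p a i *
      pot i (x (p a) i) (avg_from a i r) (wt i r) (r - last_upd (U i) a))"

lemma Phi_from_eq:
  assumes "quiet a b" "a \<le> r" "r < b"
  shows "Phi_from a r = Phi r"
  unfolding Phi_from_def Phi_eq xbar_def avg_from_def
  by (simp add: quiet_last_upd[OF assms] quiet_prices[OF assms])

lemma elapsed_quiet:
  assumes "quiet a b" "a \<le> r" "r \<le> b"
  shows "0 \<le> r - last_upd (U i) a" "r - last_upd (U i) a \<le> 1"
  using elapsed(1)[OF quietD(1)[OF assms(1)], of i] next_upd_le[OF quietD[OF assms(1)], of i] assms by auto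

lemma Phi_from_nonneg:
  assumes "quiet a b" "a \<le> r" "r \<le> b"
  shows "0 \<le> Phi_from a r"
  unfolding Phi_from_def using price_pos[OF quietD(1)[OF assms(1)]] pot_nonneg elapsed_quiet[OF assms]
  by (intro sum_nonneg mult_nonneg_nonneg) (auto intro: less_imp_le)

text \<open>The one-good step is applied with old elapsed time \<open>a - last_upd (U i) a\<close>
  and step length \<open>r - a\<close>, then summed with the constant weights
  \<open>p a i\<close>.\<close>

lemma quiet_flow:
  assumes q: "quiet a b" and r: "a < r" "r \<le> b"
  shows "(1 + \<kappa> * (\<alpha>2 - 1) / 2 * (r - a)) * Phi_from a r \<le> Phi a"
    and "Phi_from a r + (r - a) * (lam * \<alpha>1 / (2 * (1 + \<alpha>2)) *
            (\<Sum>i\<in>UNIV. p a i * span3 (x (p a) i) (avg_from a i r) (wt i r))) \<le> Phi a"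
proof -
  note a = quietD(1)[OF q]
  define \<tau> where "\<tau> i = last_upd (U i) a" for i
  define P where "P i = pot i (x (p a) i) (avg_from a i r) (wt i r) (r - \<tau> i)" for i
  define Q where "Q i = pot i (x (p a) i) (xbar x p U i a) (wt i a) (a - \<tau> i)" for i
  define S where "S i = span3 (x (p a) i) (avg_from a i r) (wt i r)" for i
  have \<tau>: "0 \<le> \<tau> i" "\<tau> i \<le> a" for i using last_upd_in[OF a, of i] by (auto simp: \<tau>_def)
  \<comment> \<open>If \<open>a\<close> is itself an update time of good \<open>i\<close>, the old
    average has weight 0, so its conventional value there does not matter.\<close>
  have mean: "((a - \<tau> i) + (r - a)) * avg_from a i r = (a - \<tau> i) * xbar x p U i a + (r - a) * x (p a) i" for i
  proof -
    have "(r - \<tau> i) * avg_from a i r = w i * (r - \<tau> i) - (s i r - s i (\<tau> i))"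
      using avg_on_demand[of "\<tau> i" r i] \<tau>[of i] r by (simp add: avg_from_def \<tau>_def[symmetric])
    moreover have "(a - \<tau> i) * xbar x p U i a = w i * (a - \<tau> i) - (s i a - s i (\<tau> i))"
    proof (cases "\<tau> i = a")
      case True
      thus ?thesis by simp
    next
      case False
      thus ?thesis using avg_on_demand[of "\<tau> i" a i] \<tau>[of i] by (simp add: xbar_def \<tau>_def[symmetric])
    qed
    ultimately show ?thesis using quiet_stock[OF q, of r i] r by (simp add: algebra_simps)
  qed
  have T: "0 \<le> a - \<tau> i" "0 < r - a" "(a - \<tau> i) + (r - a) \<le> 1" for i
    using \<tau>[of i] r elapsed_quiet(2)[OF q, of r i] by (auto simp: \<tau>_def)
  have g: "0 < lam * \<alpha>1" using lambda_pos alpha1_pos by simp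
  note step = flow_step[OF g c4(2) T kappa_pos c4(1) a2_range mean quiet_wt[OF q less_imp_le[OF r(1)] r(2)]]
  have D1: "P i + (r - a) * (\<kappa> * (\<alpha>2 - 1) / 2 * (S i + \<alpha>2 * \<bar>wt i r - w i\<bar>)) \<le> Q i" for i
    using step(1)[of i] by (simp add: P_def Q_def S_def pot_def)
  have D2: "P i + (r - a) * (lam * \<alpha>1 / (2 * (1 + \<alpha>2)) * S i) \<le> Q i" for i
    using step(2)[of i] by (simp add: P_def Q_def S_def pot_def)
  have PhiP: "Phi_from a r = (\<Sum>i\<in>UNIV. p a i * P i)" and PhiQ: "Phi a = (\<Sum>i\<in>UNIV. p a i * Q i)"
    by (simp_all add: Phi_from_def Phi_eq P_def Q_def \<tau>_def)
  have pa: "0 \<le> p a i" for i using price_pos[OF a, of i] by simp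
  have damped: "(1 + \<kappa> * (\<alpha>2 - 1) / 2 * (r - a)) * P i \<le> Q i" for i
  proof -
    have "P i \<le> S i + \<alpha>2 * \<bar>wt i r - w i\<bar>"
      unfolding P_def S_def using \<tau>[of i] r by (intro pot_le) auto
    hence "(r - a) * (\<kappa> * (\<alpha>2 - 1) / 2 * P i) \<le> (r - a) * (\<kappa> * (\<alpha>2 - 1) / 2 * (S i + \<alpha>2 * \<bar>wt i r - w i\<bar>))"
      using r kappa_pos a2_range by (intro mult_left_mono) auto
    with D1[of i] have "P i + (r - a) * (\<kappa> * (\<alpha>2 - 1) / 2 * P i) \<le> Q i" by linarith
    thus ?thesis by (simp add: algebra_simps)
  qed
  have scale: "(\<Sum>i\<in>UNIV. p a i * (c * P i)) = c * (\<Sum>i\<in>UNIV. p a i * P i)" for c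
    unfolding sum_distrib_left by (rule sum.cong) simp_all
  have "p a i * ((1 + \<kappa> * (\<alpha>2 - 1) / 2 * (r - a)) * P i) \<le> p a i * Q i" for i
    using pa damped by (intro mult_left_mono) auto
  hence "(\<Sum>i\<in>UNIV. p a i * ((1 + \<kappa> * (\<alpha>2 - 1) / 2 * (r - a)) * P i)) \<le> Phi a"
    unfolding PhiQ by (intro sum_mono) auto
  thus "(1 + \<kappa> * (\<alpha>2 - 1) / 2 * (r - a)) * Phi_from a r \<le> Phi a"
    unfolding PhiP scale .
  have lin: "(\<Sum>i\<in>UNIV. p a i * (P i + h * (c * S i)))
      = (\<Sum>i\<in>UNIV. p a i * P i) + h * (c * (\<Sum>i\<in>UNIV. p a i * S i))" for h c
    unfolding sum_distrib_left sum.distrib[symmetric] by (rule sum.cong) (simp_all add: algebra_simps)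
  have "p a i * (P i + (r - a) * (lam * \<alpha>1 / (2 * (1 + \<alpha>2)) * S i)) \<le> p a i * Q i" for i
    using pa D2 by (intro mult_left_mono) auto
  hence "(\<Sum>i\<in>UNIV. p a i * (P i + (r - a) * (lam * \<alpha>1 / (2 * (1 + \<alpha>2)) * S i))) \<le> Phi a"
    unfolding PhiQ by (intro sum_mono) auto
  thus "Phi_from a r + (r - a) * (lam * \<alpha>1 / (2 * (1 + \<alpha>2)) *
            (\<Sum>i\<in>UNIV. p a i * span3 (x (p a) i) (avg_from a i r) (wt i r))) \<le> Phi a"
    unfolding PhiP S_def[symmetric] lin .
qed

subsection \<open>Simultaneous updates\<close>

lemma own_price_deriv:
  assumes q: "q \<in> pos_prices" and c: "0 < c"
  shows "\<exists>D. ((\<lambda>c. x (q(k := c)) k) has_real_derivative D) (at c)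
     \<and> x (q(k := c)) k / c \<le> - D \<and> - D \<le> E * x (q(k := c)) k / c"
proof -
  have "q(k := c) \<in> pos_prices" using q c by (auto simp: pos_prices_def)
  from elasticity[OF this, of k] show ?thesis by simp
qed

lemma own_price_change:
  fixes k
  assumes q: "q \<in> pos_prices" and c: "0 < a" "a \<le> b"
  defines "g \<equiv> \<lambda>c. x (q(k := c)) k"
  shows "g a - g b \<le> E * (g a / a) * (b - a)"
    and "a * g a - b * g b \<le> (E - 1) * g a * (b - a)"
proof -
  have pos: "0 < g c" if "a \<le> c" "c \<le> b" for c
    unfolding g_def using that c q by (intro x_pos) (auto simp: pos_prices_def)
  have der: "\<exists>D. (g has_real_derivative D) (at c) \<and> g c / c \<le> - D \<and> - D \<le> E * g c / c"
    if "a \<le> c" "c \<le> b" for c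
    unfolding g_def using own_price_deriv[OF q, of c k] that c by simp
  show "g a - g b \<le> E * (g a / a) * (b - a)" by (rule demand_drop[OF der pos c E_ge])
  show "a * g a - b * g b \<le> (E - 1) * g a * (b - a)" by (rule spending_drop[OF der pos c E_ge])
qed

text \<open>By WGS every term inside the absolute values is nonnegative, so the sum is a difference
  of total spendings on the other goods.\<close>

lemma spending_transfer:
  assumes q: "q \<in> pos_prices" and c: "q k \<le> c"
  shows "(\<Sum>i\<in>UNIV - {k}. q i * \<bar>x (q(k := c)) i - x q i\<bar>) = q k * x q k - c * x (q(k := c)) k"
proof -
  have q': "q(k := c) \<in> pos_prices" using q c by (auto simp: pos_prices_def intro: less_le_trans)
  have "(\<Sum>i\<in>UNIV - {k}. q i * \<bar>x (q(k := c)) i - x q i\<bar>)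
      = (\<Sum>i\<in>UNIV - {k}. (q(k := c)) i * x (q(k := c)) i - q i * x q i)"
    using WGS[OF q _ c] by (intro sum.cong) (auto simp: algebra_simps)
  also have "\<dots> = (M - c * x (q(k := c)) k) - (M - q k * x q k)"
    using fixed_spending[OF q'] fixed_spending[OF q]
    by (simp add: sum_subtractf sum.remove[of UNIV k])
  finally show ?thesis by simp
qed

definition mixed_prices :: "real \<Rightarrow> real \<Rightarrow> 'n set \<Rightarrow> 'n \<Rightarrow> real" where
  "mixed_prices a b A = (\<lambda>i. if i \<in> A then p b i else p a i)"

text \<open>Intermediate potential while the goods of A have already been repriced. For a good not
  in A, the distance of its demand to its original demand is charged on top of the original
  span: the demand bound is only available for the original demand.\<close>
definition mixed_pot :: "real \<Rightarrow> real \<Rightarrow> 'n set \<Rightarrow> 'n \<Rightarrow> real \<Rightarrow> real" where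
  "mixed_pot a b A i y =
     (if i \<in> A then \<bar>y - wt i b\<bar> + \<alpha>2 * \<bar>wt i b - w i\<bar>
      else pot i (x (p a) i) (avg_from a i b) (wt i b) (b - last_upd (U i) a) + \<bar>y - x (p a) i\<bar>)"

definition mixed_Phi :: "real \<Rightarrow> real \<Rightarrow> 'n set \<Rightarrow> real" where
  "mixed_Phi a b A = (\<Sum>i\<in>UNIV. mixed_prices a b A i * mixed_pot a b A i (x (mixed_prices a b A) i))"

lemma mixed_prices_pos: "quiet a b \<Longrightarrow> mixed_prices a b A \<in> pos_prices"
  using price_pos quietD(1,2)[of a b] by (auto simp: mixed_prices_def pos_prices_def)

lemma mixed_prices_insert: "mixed_prices a b (insert k A) = (mixed_prices a b A)(k := p b k)"
  by (auto simp: mixed_prices_def)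

text \<open>\<open>mixed_pot\<close> is 1-Lipschitz in its demand argument, so repricing
  \<open>k\<close> raises all other summands by at most the displaced spending \<Delta>, which the
  own summand of \<open>k\<close> has to absorb.\<close>

lemma mixed_Phi_step:
  assumes q: "quiet a b" and k: "k \<notin> A"
    and tr: "(\<Sum>i\<in>UNIV - {k}. mixed_prices a b A i *
                \<bar>x (mixed_prices a b (insert k A)) i - x (mixed_prices a b A) i\<bar>) \<le> \<Delta>"
    and own: "p b k * (\<bar>x (mixed_prices a b (insert k A)) k - wt k b\<bar> + \<alpha>2 * \<bar>wt k b - w k\<bar>) + \<Delta>
               \<le> p a k * mixed_pot a b A k (x (mixed_prices a b A) k)"
  shows "mixed_Phi a b (insert k A) \<le> mixed_Phi a b A"
proof -
  define r where "r = mixed_prices a b A"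
  define y where "y = x r"
  define y' where "y' = x (mixed_prices a b (insert k A))"
  have r: "0 < r i" for i using mixed_prices_pos[OF q, of A] by (simp add: r_def pos_prices_def)
  have "mixed_prices a b (insert k A) i * mixed_pot a b (insert k A) i (y' i)
      \<le> r i * mixed_pot a b A i (y i) + r i * \<bar>y' i - y i\<bar>" if "i \<noteq> k" for i
  proof -
    have "mixed_pot a b (insert k A) i (y' i) \<le> mixed_pot a b A i (y i) + \<bar>y' i - y i\<bar>"
      using that by (auto simp: mixed_pot_def)
    hence "r i * mixed_pot a b (insert k A) i (y' i) \<le> r i * (mixed_pot a b A i (y i) + \<bar>y' i - y i\<bar>)"
      using r[of i] by (intro mult_left_mono) auto
    moreover have "mixed_prices a b (insert k A) i = r i" using that by (simp add: mixed_prices_def r_def)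
    ultimately show ?thesis by (simp add: distrib_left)
  qed
  hence "(\<Sum>i\<in>UNIV - {k}. mixed_prices a b (insert k A) i * mixed_pot a b (insert k A) i (y' i))
      \<le> (\<Sum>i\<in>UNIV - {k}. r i * mixed_pot a b A i (y i) + r i * \<bar>y' i - y i\<bar>)"
    by (intro sum_mono) auto
  also have "\<dots> \<le> (\<Sum>i\<in>UNIV - {k}. r i * mixed_pot a b A i (y i)) + \<Delta>"
    using tr by (simp add: sum.distrib r_def y_def y'_def)
  finally have others: "(\<Sum>i\<in>UNIV - {k}. mixed_prices a b (insert k A) i * mixed_pot a b (insert k A) i (y' i))
      \<le> (\<Sum>i\<in>UNIV - {k}. r i * mixed_pot a b A i (y i)) + \<Delta>" .
  have self: "mixed_prices a b (insert k A) k * mixed_pot a b (insert k A) k (y' k) + \<Delta> \<le> r k * mixed_pot a b A k (y k)"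
    using own k by (simp add: mixed_prices_def[of a b _] mixed_pot_def[of a b "insert k A"] r_def y_def y'_def)
  show ?thesis
    unfolding mixed_Phi_def y_def[symmetric] y'_def[symmetric] r_def[symmetric]
      sum.remove[OF finite UNIV_I, of _ k]
    using others self by linarith
qed

lemma new_price:
  assumes q: "quiet a b" and k: "b \<in> U k"
  shows "p b k = p a k * (1 + lam * median3 (-1) ((avg_from a k b - wt k b) / w k) 1)"
  using update[OF k] p_const[of a k] quietD(1,2)[OF q] quietD(3)[OF q, of k] prev_upd_eq[of a b k] by (simp add: avg_from_def)

text \<open>At time \<open>b\<close> the hypothesis \<open>x_le\<close> concerns the new prices. The
  bound for the old ones holds throughout [a, b) and passes to \<open>b\<close> because the target
  demand is affine in time.\<close>

lemma demand_bound_left_limit: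
  assumes q: "quiet a b"
  shows "x (p a) k \<le> d * wt k b"
proof -
  let ?f = "\<lambda>r. d * (wt k a + \<kappa> * (w k - x (p a) k) * (r - a)) - x (p a) k"
  have "0 \<le> ?f b"
  proof (rule nonneg_at_right_endpoint[where a = a and f = ?f])
    show "continuous_on {a..b} ?f" by (intro continuous_intros)
    show "0 \<le> ?f r" if "a \<le> r" "r < b" for r
      using x_le[of r k] quiet_prices[OF q that] quiet_wt[OF q, of r k] that quietD(1)[OF q] by simp
  qed (rule quietD(2)[OF q])
  thus ?thesis using quiet_wt[OF q, of b k] quietD(2)[OF q] by simp
qed

lemma avg_from_nonneg:
  assumes q: "quiet a b"
  shows "0 \<le> avg_from a k b"
  unfolding avg_from_def using last_upd_in[OF quietD(1)[OF q], of k] quietD(2)[OF q]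
  by (intro avg_on_demand_nonneg) auto

lemma mixed_Phi_increase:
  assumes q: "quiet a b" and k: "b \<in> U k" "k \<notin> A" and up: "wt k b \<le> avg_from a k b"
  shows "mixed_Phi a b (insert k A) \<le> mixed_Phi a b A"
proof -
  note a = quietD(1,2)[OF q]
  define m where "m = min 1 ((avg_from a k b - wt k b) / w k)"
  define r where "r = mixed_prices a b A"
  have r: "r \<in> pos_prices" using mixed_prices_pos[OF q] by (simp add: r_def)
  have rk: "r k = p a k" "r(k := p a k) = r" using k by (auto simp: r_def mixed_prices_def)
  have r': "mixed_prices a b (insert k A) = r(k := p b k)" by (simp add: mixed_prices_insert r_def)
  have m0: "0 \<le> m" using up w_pos[of k] by (simp add: m_def)
  have pb: "p b k = p a k * (1 + lam * m)"
    unfolding new_price[OF q k(1)] m_def using up w_pos[of k] by (subst median3_up) auto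
  have pa: "0 < p a k" using price_pos a by simp
  have le: "p a k \<le> p b k" using pb pa m0 lambda_pos by simp
  have pbk: "r(k := p b k) \<in> pos_prices" using r le pa by (auto simp: pos_prices_def)
  have diff: "p b k - p a k = p a k * (lam * m)" by (simp add: pb algebra_simps)
  note ch = own_price_change[OF r pa le, of k, unfolded rk diff]
  show ?thesis
  proof (rule mixed_Phi_step[OF q k(2)])
    show "(\<Sum>i\<in>UNIV - {k}. mixed_prices a b A i *
                \<bar>x (mixed_prices a b (insert k A)) i - x (mixed_prices a b A) i\<bar>)
         \<le> p a k * x r k - p a k * (1 + lam * m) * x (r(k := p b k)) k"
      unfolding r' r_def[symmetric] using spending_transfer[OF r, of k "p b k"] le rk pb by simp
    have lo: "x r k * (1 - E * (lam * m)) \<le> x (r(k := p b k)) k"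
      using ch(1) pa by (simp add: algebra_simps)
    have sp: "p a k * x r k - p a k * (1 + lam * m) * x (r(k := p b k)) k
        \<le> (E - 1) * x r k * (p a k * (lam * m))" using ch(2) by (simp add: pb)
    have T: "0 \<le> b - last_upd (U k) a" "b - last_upd (U k) a \<le> 1" using elapsed_quiet[OF q, of b k] a by auto
    have wc: "\<bar>wt k b - w k\<bar> \<le> w k / 3" using wtil_close[of b k] a by simp
    show "p b k * (\<bar>x (mixed_prices a b (insert k A)) k - wt k b\<bar> + \<alpha>2 * \<bar>wt k b - w k\<bar>)
          + (p a k * x r k - p a k * (1 + lam * m) * x (r(k := p b k)) k)
         \<le> p a k * mixed_pot a b A k (x (mixed_prices a b A) k)"
      using price_increase[OF pa x_pos[OF r] x_pos[OF pbk] w_pos wc m_def up lo sp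
          demand_bound_left_limit[OF q] T lambda_pos E_ge alpha1_pos a2_range d_ge c1 c2 c3 c4(2)] k
      unfolding r' r_def[symmetric] pb by (simp add: mixed_pot_def pot_def algebra_simps)
  qed
qed

lemma mixed_Phi_decrease:
  assumes q: "quiet a b" and k: "b \<in> U k" "k \<notin> A" and down: "avg_from a k b \<le> wt k b"
    and yx: "x (mixed_prices a b A) k \<le> x (p a) k"
  shows "mixed_Phi a b (insert k A) \<le> mixed_Phi a b A"
proof -
  note a = quietD(1,2)[OF q]
  define m where "m = min 1 ((wt k b - avg_from a k b) / w k)"
  define r where "r = mixed_prices a b A"
  have r: "r \<in> pos_prices" using mixed_prices_pos[OF q] by (simp add: r_def)
  have rk: "r k = p a k" "r(k := p a k) = r" using k by (auto simp: r_def mixed_prices_def)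
  have r': "mixed_prices a b (insert k A) = r(k := p b k)" by (simp add: mixed_prices_insert r_def)
  have m0: "0 \<le> m" using down w_pos[of k] by (simp add: m_def)
  have neg: "- ((avg_from a k b - wt k b) / w k) = (wt k b - avg_from a k b) / w k"
    unfolding minus_divide_left by simp
  have pb: "p b k = p a k * (1 - lam * m)"
    unfolding new_price[OF q k(1)] m_def using down w_pos[of k]
    by (subst median3_down) (auto simp: neg divide_nonpos_pos)
  have pa: "0 < p a k" "0 < p b k" using price_pos a by auto
  have le: "p b k \<le> p a k" using pb pa m0 lambda_pos by simp
  have pbk: "r(k := p b k) \<in> pos_prices" using r pa by (auto simp: pos_prices_def)
  have diff: "p a k - p b k = p a k * (lam * m)" by (simp add: pb algebra_simps)
  note ch = own_price_change[OF r pa(2) le, of k, unfolded rk diff]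
  show ?thesis
  proof (rule mixed_Phi_step[OF q k(2)])
    \<comment> \<open>A decrease is read backwards, as an increase from \<open>p b k\<close> to
      \<open>p a k\<close>, so that \<open>spending_transfer\<close> applies.\<close>
    have "(\<Sum>i\<in>UNIV - {k}. r i * \<bar>x (r(k := p b k)) i - x r i\<bar>)
        = (\<Sum>i\<in>UNIV - {k}. (r(k := p b k)) i * \<bar>x ((r(k := p b k))(k := p a k)) i - x (r(k := p b k)) i\<bar>)"
      using rk by (intro sum.cong) (auto simp: abs_minus_commute)
    also have "\<dots> = p a k * (1 - lam * m) * x (r(k := p b k)) k - p a k * x r k"
      using spending_transfer[OF pbk, of k "p a k"] le rk pb by simp
    finally show "(\<Sum>i\<in>UNIV - {k}. mixed_prices a b A i *
                \<bar>x (mixed_prices a b (insert k A)) i - x (mixed_prices a b A) i\<bar>)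
         \<le> p a k * (1 - lam * m) * x (r(k := p b k)) k - p a k * x r k"
      unfolding r' r_def[symmetric] by simp
    have sp: "p a k * (1 - lam * m) * x (r(k := p b k)) k - p a k * x r k
        \<le> (E - 1) * x (r(k := p b k)) k * (p a k * (lam * m))" using ch(2) by (simp add: pb)
    have T: "0 \<le> b - last_upd (U k) a" "b - last_upd (U k) a \<le> 1" using elapsed_quiet[OF q, of b k] a by auto
    have wc: "\<bar>wt k b - w k\<bar> \<le> w k / 3" using wtil_close[of b k] a by simp
    show "p b k * (\<bar>x (mixed_prices a b (insert k A)) k - wt k b\<bar> + \<alpha>2 * \<bar>wt k b - w k\<bar>)
          + (p a k * (1 - lam * m) * x (r(k := p b k)) k - p a k * x r k)
         \<le> p a k * mixed_pot a b A k (x (mixed_prices a b A) k)"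
      using price_decrease[OF pa(1) x_pos[OF r] x_pos[OF pbk] w_pos wc m_def down avg_from_nonneg[OF q] sp
          demand_bound_left_limit[OF q] yx[folded r_def] T lambda_pos E_ge alpha1_pos a2_range d_ge c1 c2 c3] k
      unfolding r' r_def[symmetric] pb by (simp add: mixed_pot_def pot_def algebra_simps)
  qed
qed

text \<open>Restoring the old, higher price of one good of \<open>A\<close> can only raise the
  demand for \<open>k\<close>, by WGS.\<close>

lemma demand_after_others_decrease:
  assumes q: "quiet a b" and A: "finite A" "\<And>j. j \<in> A \<Longrightarrow> p b j \<le> p a j"
  shows "k \<notin> A \<Longrightarrow> x (mixed_prices a b A) k \<le> x (p a) k"
  using A
proof (induction A)
  case empty
  thus ?case by (simp add: mixed_prices_def)
next
  case (insert j A)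
  let ?r = "mixed_prices a b (insert j A)"
  have "x ?r k \<le> x (?r(j := p a j)) k"
    using insert.prems by (intro WGS mixed_prices_pos[OF q]) (auto simp: mixed_prices_def)
  also have "?r(j := p a j) = mixed_prices a b A"
    using insert.hyps by (auto simp: mixed_prices_def)
  also have "x (mixed_prices a b A) k \<le> x (p a) k" using insert by auto
  finally show ?case .
qed

text \<open>Price decreases are applied before increases, so that no good with a decreasing price
  sees its demand pushed above the assumed bound by the other updates at the same instant.\<close>
lemma jump:
  assumes q: "quiet a b"
  shows "Phi b \<le> Phi_from a b"
proof -
  note a = quietD(1,2)[OF q]
  define D where "D = {k. b \<in> U k \<and> avg_from a k b \<le> wt k b}"
  define I where "I = {k. b \<in> U k \<and> wt k b < avg_from a k b}"
  have dec: "p b j \<le> p a j" if "j \<in> D" for j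
  proof -
    have "(avg_from a j b - wt j b) / w j \<le> 0" using that w_pos[of j] by (simp add: D_def divide_nonpos_pos)
    hence "lam * median3 (-1) ((avg_from a j b - wt j b) / w j) 1 \<le> 0"
      using lambda_pos by (simp add: median3_down mult_nonneg_nonpos)
    thus ?thesis using new_price[OF q, of j] that price_pos[of a j] a
      by (simp add: D_def mult_le_cancel_left2)
  qed
  have 1: "mixed_Phi a b A \<le> mixed_Phi a b {}" if "A \<subseteq> D" for A
    using finite[of A] that
  proof (induction A)
    case (insert k A)
    have "x (mixed_prices a b A) k \<le> x (p a) k"
      using insert dec by (intro demand_after_others_decrease[OF q]) auto
    hence "mixed_Phi a b (insert k A) \<le> mixed_Phi a b A"
      using insert by (intro mixed_Phi_decrease[OF q]) (auto simp: D_def)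
    thus ?case using insert by simp
  qed simp
  have 2: "mixed_Phi a b (D \<union> A) \<le> mixed_Phi a b D" if "A \<subseteq> I" for A
    using finite[of A] that
  proof (induction A)
    case (insert k A)
    have "mixed_Phi a b (insert k (D \<union> A)) \<le> mixed_Phi a b (D \<union> A)"
      using insert by (intro mixed_Phi_increase[OF q]) (auto simp: D_def I_def)
    thus ?case using insert by simp
  qed simp
  have DI: "k \<in> D \<union> I \<longleftrightarrow> b \<in> U k" for k by (auto simp: D_def I_def)
  have start: "mixed_Phi a b {} = Phi_from a b"
    by (simp add: mixed_Phi_def mixed_pot_def mixed_prices_def Phi_from_def)
  have no_upd: "last_upd (U k) b = last_upd (U k) a" if "b \<notin> U k" for k
  proof (rule last_upd_eq)
    show "U k \<inter> {a<..b} = {}"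
    proof (rule equals0I)
      fix v assume v: "v \<in> U k \<inter> {a<..b}"
      hence "v \<noteq> b" using that by auto
      thus False using v quietD(3)[OF q, of k] by auto
    qed
  qed (use a in auto)
  have same: "p b k = p a k" if "b \<notin> U k" for k
    using p_const[of b k] p_const[of a k] no_upd[OF that] a by simp
  have prices: "mixed_prices a b (D \<union> I) = p b"
    unfolding mixed_prices_def using DI same by auto
  \<comment> \<open>For a repriced good the average equals the new demand and the elapsed time is 0,
    so the span is the distance of demand to target. For the others the Lipschitz bound of the span
    applies.\<close>
  have "Phi b \<le> mixed_Phi a b (D \<union> I)"
    unfolding Phi_eq mixed_Phi_def prices
  proof (intro sum_mono mult_left_mono)
    fix k
    show "pot k (x (p b) k) (xbar x p U k b) (wt k b) (b - last_upd (U k) b)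
        \<le> mixed_pot a b (D \<union> I) k (x (p b) k)"
    proof (cases "b \<in> U k")
      case True
      have l: "last_upd (U k) b = b"
        using last_upd_ge[OF True order_refl] last_upd_in[of b k] a by simp
      show ?thesis using True DI unfolding mixed_pot_def pot_def xbar_def avg_on_def l
        by (simp add: span3_def max_def min_def)
    next
      case False
      have e: "xbar x p U k b = avg_from a k b" by (simp add: xbar_def avg_from_def no_upd[OF False])
      show ?thesis using False DI span3_lipschitz[of "x (p b) k" "avg_from a k b" "wt k b" "x (p a) k"]
        unfolding mixed_pot_def pot_def e no_upd[OF False] by simp
    qed
    show "0 \<le> p b k" using price_pos[of b k] a by simp
  qed
  also have "\<dots> \<le> mixed_Phi a b D" by (rule 2) simp
  also have "\<dots> \<le> mixed_Phi a b {}" by (rule 1) simp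
  finally show ?thesis unfolding start .
qed

section \<open>Decay over one day\<close>

lemma quiet_decay:
  assumes q: "quiet a b"
  shows "(1 + \<kappa> * (\<alpha>2 - 1) / 2 * (b - a)) * Phi b \<le> Phi a"
proof -
  have "(1 + \<kappa> * (\<alpha>2 - 1) / 2 * (b - a)) * Phi b \<le> (1 + \<kappa> * (\<alpha>2 - 1) / 2 * (b - a)) * Phi_from a b"
    using jump[OF q] kappa_pos a2_range quietD(2)[OF q] by (intro mult_left_mono) auto
  also have "\<dots> \<le> Phi a" using quiet_flow(1)[OF q quietD(2)[OF q]] by simp
  finally show ?thesis .
qed

text \<open>The start \<open>c\<close> lies strictly after \<open>a\<close> to keep the denominator
  away from 0 when \<open>a\<close> is an update time.\<close>

lemma continuous_avg_from:
  assumes q: "quiet a b" and c: "a < c"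
  shows "continuous_on {c..b} (avg_from a i)"
proof -
  define \<tau> where "\<tau> = last_upd (U i) a"
  have \<tau>: "0 \<le> \<tau>" "\<tau> \<le> a" using last_upd_in[OF quietD(1)[OF q], of i] by (auto simp: \<tau>_def)
  have eq: "avg_from a i r = (w i * (r - \<tau>) - (s i a + (r - a) * (w i - x (p a) i) - s i \<tau>)) / (r - \<tau>)"
    if "r \<in> {c..b}" for r
    using avg_on_demand[of \<tau> r i] quiet_stock[OF q, of r i] \<tau> that c
    by (simp add: avg_from_def \<tau>_def[symmetric])
  show ?thesis
    by (rule continuous_on_eq[OF _ eq[symmetric]], intro continuous_intros) (use \<tau> c in auto)
qed

lemma quiet_decay_small_imbalance:
  assumes q: "quiet a b"
    and small: "\<And>r. a \<le> r \<Longrightarrow> r \<le> b \<Longrightarrow>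
      2 * (1 + 2 * \<alpha>2) * (\<Sum>i\<in>UNIV. \<bar>wt i r - w i\<bar> * p r i) \<le> Phi r"
  shows "(1 + lam * \<alpha>1 / (4 * (1 + \<alpha>2)) * (b - a)) * Phi b \<le> Phi a"
proof -
  note a = quietD(1,2)[OF q]
  define W where "W r = (\<Sum>i\<in>UNIV. \<bar>wt i r - w i\<bar> * p a i)" for r
  define S where "S = (\<Sum>i\<in>UNIV. p a i * span3 (x (p a) i) (avg_from a i b) (wt i b))"
  define \<theta> where "\<theta> = lam * \<alpha>1 / (2 * (1 + \<alpha>2))"
  have \<theta>: "0 \<le> \<theta>" using lambda_pos alpha1_pos a2_range by (simp add: \<theta>_def)
  have pa: "0 < p a i" for i using price_pos a by simp
  have W0: "0 \<le> W b" unfolding W_def using pa by (intro sum_nonneg mult_nonneg_nonneg) (auto intro: less_imp_le)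
  \<comment> \<open>Smallness at \<open>b\<close> is stated for the new prices; here it is needed
    for the old ones. It is carried to \<open>b\<close> by continuity from the right half, which
    avoids the possible singularity of the average at \<open>a\<close>.\<close>
  let ?c = "(a + b) / 2"
  have "0 \<le> Phi_from a b - 2 * (1 + 2 * \<alpha>2) * W b"
  proof (rule nonneg_at_right_endpoint[where a = ?c and b = b and
        f = "\<lambda>r. Phi_from a r - 2 * (1 + 2 * \<alpha>2) * W r"])
    have wtc: "continuous_on {?c..b} (wt i)" for i
    proof -
      have eq: "wt i r = wt i a + \<kappa> * (w i - x (p a) i) * (r - a)" if "r \<in> {?c..b}" for r
        using that a by (intro quiet_wt[OF q]) auto
      show ?thesis
        by (rule continuous_on_eq[OF _ eq[symmetric]], intro continuous_intros)
    qed
    have avc: "continuous_on {?c..b} (avg_from a i)" for i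
      using a by (intro continuous_avg_from[OF q]) auto
    show "continuous_on {?c..b} (\<lambda>r. Phi_from a r - 2 * (1 + 2 * \<alpha>2) * W r)"
      unfolding Phi_from_def W_def pot_def span3_def
      by (intro continuous_intros continuous_on_max continuous_on_min wtc avc)
    show "0 \<le> Phi_from a r - 2 * (1 + 2 * \<alpha>2) * W r" if "?c \<le> r" "r < b" for r
    proof -
      have r: "a \<le> r" "r < b" using that a by auto
      show ?thesis using small[of r] r Phi_from_eq[OF q r] quiet_prices[OF q r] by (simp add: W_def)
    qed
  qed (use a in simp)
  hence W: "2 * W b + 4 * (\<alpha>2 * W b) \<le> Phi_from a b" by (simp add: algebra_simps)
  have "Phi_from a b \<le> (\<Sum>i\<in>UNIV. p a i * (span3 (x (p a) i) (avg_from a i b) (wt i b) + \<alpha>2 * \<bar>wt i b - w i\<bar>))"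
    unfolding Phi_from_def using pa elapsed_quiet(1)[OF q, of b] a
    by (intro sum_mono mult_left_mono pot_le) (auto intro: less_imp_le)
  also have "\<dots> = S + \<alpha>2 * W b"
    by (simp add: S_def W_def distrib_left sum.distrib sum_distrib_left mult_ac)
  \<comment> \<open>By \<open>W\<close> the term \<open>\<alpha>2 * W b\<close> is at most a quarter
    of \<open>Phi_from a b\<close>, so the spans carry at least half of it.\<close>
  finally have "Phi_from a b / 2 \<le> S" using W W0 a2_range Phi_from_nonneg[OF q, of b] a
    by (smt (verit) field_sum_of_halves mult_nonneg_nonneg)
  hence "(b - a) * (\<theta> * (Phi_from a b / 2)) \<le> (b - a) * (\<theta> * S)"
    using \<theta> a by (intro mult_left_mono) auto
  moreover have "Phi_from a b + (b - a) * (\<theta> * S) \<le> Phi a"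
    using quiet_flow(2)[OF q a(2) order_refl] by (simp add: S_def \<theta>_def)
  ultimately have "Phi_from a b + (b - a) * (\<theta> * (Phi_from a b / 2)) \<le> Phi a" by linarith
  moreover have "Phi_from a b + (b - a) * (\<theta> * (Phi_from a b / 2))
      = (1 + lam * \<alpha>1 / (4 * (1 + \<alpha>2)) * (b - a)) * Phi_from a b"
    using a2_range by (simp add: \<theta>_def field_simps)
  moreover have "(1 + lam * \<alpha>1 / (4 * (1 + \<alpha>2)) * (b - a)) * Phi b
      \<le> (1 + lam * \<alpha>1 / (4 * (1 + \<alpha>2)) * (b - a)) * Phi_from a b"
    using jump[OF q] lambda_pos alpha1_pos a2_range a by (intro mult_left_mono) (auto intro!: add_nonneg_nonneg)
  ultimately show ?thesis by linarith
qed

lemma decay_over_unit: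
  assumes t: "0 \<le> t" and \<rho>: "0 \<le> \<rho>" "\<rho> \<le> 1"
    and step: "\<And>a b. t \<le> a \<Longrightarrow> b \<le> t + 1 \<Longrightarrow> quiet a b \<Longrightarrow> (1 + \<rho> * (b - a)) * Phi b \<le> Phi a"
  shows "Phi (t + 1) \<le> (1 - \<rho> / 2) * Phi t"
proof -
  have "finite ((\<Union>i. U i) \<inter> {t<..t + 1})"
  proof (rule finite_subset)
    show "(\<Union>i. U i) \<inter> {t<..t + 1} \<subseteq> (\<Union>i. U i \<inter> {0..t + 1})" using t by auto
    show "finite (\<Union>i. U i \<inter> {0..t + 1})" by (rule finite_UN_I) (auto intro: U_finite)
  qed
  hence "(1 + \<rho> * (t + 1 - t)) * Phi (t + 1) \<le> Phi t"
  proof (rule decay_compose[OF _ \<rho>(1)])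
    show "0 \<le> Phi r" if "t \<le> r" for r using that t by (intro Phi_nonneg) simp
    show "(1 + \<rho> * (b - a)) * Phi b \<le> Phi a"
      if "t \<le> a" "a < b" "b \<le> t + 1" "(\<Union>i. U i) \<inter> {a<..<b} = {}" for a b
      using that t by (intro step) (auto simp: quiet_def)
  qed simp
  thus ?thesis using backward_euler_rate[of \<rho>] \<rho> Phi_nonneg[OF t] by simp
qed

end

theorem mainTheorem11:
  fixes x :: "('n::finite \<Rightarrow> real) \<Rightarrow> 'n \<Rightarrow> real"
    and w :: "'n \<Rightarrow> real" and M :: real
    and p :: "real \<Rightarrow> 'n \<Rightarrow> real"
    and U :: "'n \<Rightarrow> real set"
    and s :: "'n \<Rightarrow> real \<Rightarrow> real" and sstar :: "'n \<Rightarrow> real"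
    and \<kappa> lam E d \<alpha>1 \<alpha>2 :: real
  assumes w_pos: "\<And>i. 0 < w i"
    and M_pos: "0 < M"
    and x_pos: "\<And>q i. q \<in> pos_prices \<Longrightarrow> 0 < x q i"
    and fixed_spending: "\<And>q. q \<in> pos_prices \<Longrightarrow> (\<Sum>i\<in>UNIV. q i * x q i) = M"
    and WGS: "\<And>q i j c. q \<in> pos_prices \<Longrightarrow> j \<noteq> i \<Longrightarrow> q i \<le> c \<Longrightarrow> x q j \<le> x (q(i := c)) j"
    and elasticity: "\<And>q i. q \<in> pos_prices \<Longrightarrow> \<exists>D.
           ((\<lambda>c. x (q(i := c)) i) has_real_derivative D) (at (q i))
           \<and> x q i / q i \<le> - D \<and> - D \<le> E * x q i / q i"
    and E_ge: "1 \<le> E"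
    and kappa_pos: "0 < \<kappa>" and lambda_pos: "0 < lam"
    and alpha1_pos: "0 < \<alpha>1" and alpha2_pos: "0 < \<alpha>2"
    (* update times *)
    and U_nonneg: "\<And>i. U i \<subseteq> {0..}"
    and U_zero: "\<And>i. 0 \<in> U i"
    and U_finite: "\<And>i t. finite (U i \<inter> {0..t})"
    and U_gap: "\<And>i u. u \<in> U i \<Longrightarrow> \<exists>v\<in>U i. u < v \<and> v \<le> u + 1"
    (* prices: positive initially, change only at own update times *)
    and p0_pos: "p 0 \<in> pos_prices"
    and p_const: "\<And>i t. 0 \<le> t \<Longrightarrow> p t i = p (last_upd (U i) t) i"
    (* warehouse stocks *)
    and stock: "\<And>i t. 0 \<le> t \<Longrightarrow>
        ((\<lambda>r. w i - x (p r) i) has_integral (s i t - s i 0)) {0..t}"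
    (* price update rule *)
    and update: "\<And>i t. t \<in> U i \<Longrightarrow> 0 < t \<Longrightarrow>
        p t i = p (prev_upd (U i) t) i *
          (1 + lam * median3 (-1)
                 ((avg_on (\<lambda>r. x (p r) i) (prev_upd (U i) t) t - wtil w \<kappa> s sstar i t) / w i) 1)"
    (* standing assumptions of the theorem *)
    and wtil_close: "\<And>i t. 0 \<le> t \<Longrightarrow> \<bar>wtil w \<kappa> s sstar i t - w i\<bar> \<le> w i / 3"
    and x_le: "\<And>i t. 0 \<le> t \<Longrightarrow> x (p t) i \<le> d * wtil w \<kappa> s sstar i t"
    and d_ge: "2 \<le> d"
    and a2_range: "1 < \<alpha>2" "\<alpha>2 < 2"
    and c1: "\<alpha>2 / 2 + \<alpha>1 * max (3/2) (d - 1) \<le> 1"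
    and c2: "lam * E < 1"
    and c3: "lam * \<alpha>1 + 4/3 * lam * (1 + 2 * E * d / (1 - lam * E) + \<alpha>2 / 2) \<le> 1"
    and c4: "4 * \<kappa> * (1 + \<alpha>2) \<le> lam * \<alpha>1" "lam * \<alpha>1 \<le> 1/2"
    and c5: "\<kappa> * (\<alpha>2 - 1) / 2 \<le> 1"
  shows "\<forall>t\<ge>0.
      phi x p U w \<kappa> s sstar lam \<alpha>1 \<alpha>2 (t + 1)
        \<le> (1 - \<kappa> * (\<alpha>2 - 1) / 4) * phi x p U w \<kappa> s sstar lam \<alpha>1 \<alpha>2 t
      \<and> ((\<forall>r\<in>{t..t+1}. phi x p U w \<kappa> s sstar lam \<alpha>1 \<alpha>2 r
              \<ge> 2 * (1 + 2 * \<alpha>2) * (\<Sum>i\<in>UNIV. \<bar>wtil w \<kappa> s sstar i r - w i\<bar> * p r i))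
         \<longrightarrow> phi x p U w \<kappa> s sstar lam \<alpha>1 \<alpha>2 (t + 1)
               \<le> (1 - lam * \<alpha>1 / (8 * (1 + \<alpha>2))) * phi x p U w \<kappa> s sstar lam \<alpha>1 \<alpha>2 t)"
proof (intro allI impI conjI)
  interpret warehouse_market x w M p U s sstar \<kappa> lam E d \<alpha>1 \<alpha>2
    by (rule warehouse_market.intro) (fact assms)+
  fix t :: real assume t: "0 \<le> t"
  \<comment> \<open>\<open>c5\<close> says that the finite-step rate is at most 1; passing from 1/(1
    + \<rho>) to 1 - \<rho>/2 halves it, whence the 4 here and the 8 in the second bound.\<close>
  have "Phi (t + 1) \<le> (1 - \<kappa> * (\<alpha>2 - 1) / 2 / 2) * Phi t"
    using kappa_pos a2_range c5 by (intro decay_over_unit[OF t] quiet_decay) auto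
  thus "phi x p U w \<kappa> s sstar lam \<alpha>1 \<alpha>2 (t + 1)
        \<le> (1 - \<kappa> * (\<alpha>2 - 1) / 4) * phi x p U w \<kappa> s sstar lam \<alpha>1 \<alpha>2 t" by simp
  assume small: "\<forall>r\<in>{t..t+1}. phi x p U w \<kappa> s sstar lam \<alpha>1 \<alpha>2 r
              \<ge> 2 * (1 + 2 * \<alpha>2) * (\<Sum>i\<in>UNIV. \<bar>wtil w \<kappa> s sstar i r - w i\<bar> * p r i)"
  have "lam * \<alpha>1 / (4 * (1 + \<alpha>2)) \<le> 1" using c4(2) a2_range by (simp add: field_simps)
  moreover have "0 \<le> lam * \<alpha>1 / (4 * (1 + \<alpha>2))" using lambda_pos alpha1_pos a2_range by simp
  ultimately have "Phi (t + 1) \<le> (1 - lam * \<alpha>1 / (4 * (1 + \<alpha>2)) / 2) * Phi t"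
    using small by (intro decay_over_unit[OF t] quiet_decay_small_imbalance) auto
  thus "phi x p U w \<kappa> s sstar lam \<alpha>1 \<alpha>2 (t + 1)
        \<le> (1 - lam * \<alpha>1 / (8 * (1 + \<alpha>2))) * phi x p U w \<kappa> s sstar lam \<alpha>1 \<alpha>2 t"
    by (simp add: distrib_left)
qed

end
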